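(* Let $d\ge 1$ and let $L\subset\mathbb{R}^d$ be a lattice with fundamental domain $\Omega$. For every $0\le\gamma<1$ and $0<\alpha<1-\gamma$ we have the continuous embedding $$H^{\gamma}\mathrm{Lip}_{\Omega}(\alpha;2)\hookrightarrow\mathrm{Lip}_{\Omega}(\alpha+\gamma;2),$$ where $$H^{\gamma}\mathrm{Lip}_{\Omega}(\alpha;2):=\{f\in\mathrm{Lip}_{\Omega}(\alpha;2):(I-\Delta_{\Omega})^{\gamma/2}f\in\mathrm{Lip}_{\Omega}(\alpha;2)\}$$ with norm $\|f\|_{H^{\gamma}\mathrm{Lip}_{\Omega}(\alpha;2)}:=\|(I-\Delta_{\Omega})^{\gamma/2}f\|_{\mathrm{Lip}_{\Omega}(\alpha;2)}$.
   Context: A lattice is $L=A\mathbb{Z}^d$ with $A$ an invertible real $d\times d$ matrix; its dual lattice is $L^{\perp}:=(A^{T})^{-1}\mathbb{Z}^d$. A fundamental domain of $L$ is a measurable set $\Omega\subseteq\mathbb{R}^d$ such that $\Omega+L=\mathbb{R}^d$ as a direct sum (every $x\in\mathbb{R}^d$ is uniquely $\omega+\ell$ with $\omega\in\Omega$, $\ell\in L$). $L^p(\Omega)$ is taken with respect to the normalised measure $\mathrm{d}x/|\Omega|$; functions on $\Omega$ are extended $L$-periodically to $\mathbb{R}^d$, which gives meaning to $f(\cdot+h)$. The Fourier transform is $\widehat f(\kappa)=\frac{1}{|\Omega|}\int_{\Omega}f(x)e^{-2\pi i\kappa\cdot x}\,\mathrm{d}x$ for $\kappa\in L^{\perp}$.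 $\Delta_{\Omega}$ is the Fourier multiplier with symbol $-4\pi^2|\kappa|^2$, so $(I-\Delta_\Omega)^{\gamma/2}$ is the Fourier multiplier with symbol $(1+4\pi^2|\kappa|^2)^{\gamma/2}$ (the Fourier multiplier $T$ with symbol $\sigma$ is given by $\widehat{Tf}(\kappa)=\sigma(\kappa)\widehat f(\kappa)$). For $0<\alpha\le1$, $1<p\le\infty$, the additive Hölder-Lipschitz space is $$\mathrm{Lip}_{\Omega}(\alpha;p):=\{f\in L^p(\Omega): \|f(\cdot+h)-f(\cdot)\|_{L^p(\Omega)}=O(|h|^{\alpha})\text{ as }h\to0\},$$ where $O$ means: bounded by $C|h|^\alpha$ for some constant $C>0$ and all $h$ in a neighbourhood of $0$. For $0<\alpha<1$ the space $\mathrm{Lip}_{\Omega}(\alpha;2)$ is endowed with the norm $$\|f\|_{\mathrm{Lip}_{\Omega}(\alpha;2)}:=\|f\|_{L^2(\Omega)}+\sup_{N\in\mathbb{N}}N^{\alpha}\Big(\sum_{\kappa\in L^\perp,\ |\kappa|>N}|\widehat f(\kappa)|^2\Big)^{1/2}.$$ $|\cdot|$ is the Euclidean norm and $0\in\mathbb{N}$. *)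

theory Defs
  imports "HOL-Analysis.Analysis" "HOL-Library.Landau_Symbols"
begin

definition lattice :: "real^'n^'n \<Rightarrow> (real^'n) set" where
  "lattice A = (\<lambda>z. A *v z) ` {z. \<forall>i. z $ i \<in> \<int>}"

definition dual_lattice :: "real^'n^'n \<Rightarrow> (real^'n) set" where
  "dual_lattice A = lattice (matrix_inv (transpose A))"

definition fundamental_domain :: "real^'n^'n \<Rightarrow> (real^'n) set \<Rightarrow> bool" where
  "fundamental_domain A \<Omega> \<longleftrightarrow>
     \<Omega> \<in> sets lebesgue \<and>
     (\<forall>x. \<exists>!p. fst p \<in> \<Omega> \<and> snd p \<in> lattice A \<and> x = fst p + snd p)"

text \<open>An element of \<open>L\<^sup>2(\<Omega>)\<close> is represented by the lattice-periodic extension to the whole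
  space of a square-integrable function on \<open>\<Omega>\<close>. No quotient is taken: almost everywhere equal
  functions represent the same element, and all notions below respect this relation.\<close>

definition L2_space :: "real^'n^'n \<Rightarrow> (real^'n) set \<Rightarrow> (real^'n \<Rightarrow> complex) set" where
  "L2_space A \<Omega> = {f.
     (\<forall>x. \<forall>l\<in>lattice A. f (x + l) = f x) \<and>
     f \<in> borel_measurable (lebesgue_on \<Omega>) \<and>
     integrable (lebesgue_on \<Omega>) (\<lambda>x. (cmod (f x))\<^sup>2)}"

definition L2_norm :: "(real^'n) set \<Rightarrow> (real^'n \<Rightarrow> complex) \<Rightarrow> real" where
  "L2_norm \<Omega> f =
     sqrt (1 / measure lebesgue \<Omega> * (LINT x|lebesgue_on \<Omega>. (cmod (f x))\<^sup>2))"

definition fourier_coeff :: "(real^'n) set \<Rightarrow> (real^'n \<Rightarrow> complex) \<Rightarrow> real^'n \<Rightarrow> complex" where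
  "fourier_coeff \<Omega> f \<kappa> =
     complex_of_real (1 / measure lebesgue \<Omega>) *
     (LINT x|lebesgue_on \<Omega>. f x * exp (- 2 * complex_of_real pi * \<i> * complex_of_real (\<kappa> \<bullet> x)))"

definition Lip_space ::
  "real^'n^'n \<Rightarrow> (real^'n) set \<Rightarrow> real \<Rightarrow> (real^'n \<Rightarrow> complex) set" where
  "Lip_space A \<Omega> \<alpha> = {f \<in> L2_space A \<Omega>.
     (\<lambda>h. L2_norm \<Omega> (\<lambda>x. f (x + h) - f x)) \<in> O[at 0](\<lambda>h. norm h powr \<alpha>)}"

text \<open>The norm takes values in \<^typ>\<open>ennreal\<close>, so that the supremum always has its true value.
  The inner sum is finite for every element of \<open>L\<^sup>2(\<Omega>)\<close> by Bessel's inequality.\<close>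

definition Lip_norm ::
  "real^'n^'n \<Rightarrow> (real^'n) set \<Rightarrow> real \<Rightarrow> (real^'n \<Rightarrow> complex) \<Rightarrow> ennreal" where
  "Lip_norm A \<Omega> \<alpha> f =
     ennreal (L2_norm \<Omega> f) +
     (SUP N::nat. ennreal (real N powr \<alpha> *
        sqrt (\<Sum>\<^sub>\<infinity>\<kappa>\<in>{\<kappa> \<in> dual_lattice A. norm \<kappa> > real N}. (cmod (fourier_coeff \<Omega> f \<kappa>))\<^sup>2)))"

text \<open>For \<open>f\<close> in \<open>L\<^sup>2(\<Omega>)\<close> and an unbounded symbol \<open>\<sigma>\<close>, the multiplier applied to \<open>f\<close> is in
  general only a formal Fourier series. The relation below says that it is the function \<open>g\<close>
  in \<open>L\<^sup>2(\<Omega>)\<close>; such a \<open>g\<close> is unique up to almost everywhere equality, and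
  \<open>fourier_multiplier\<close> picks a representative of it whenever it exists.\<close>

definition has_fourier_multiplier ::
  "real^'n^'n \<Rightarrow> (real^'n) set \<Rightarrow> (real^'n \<Rightarrow> real) \<Rightarrow>
   (real^'n \<Rightarrow> complex) \<Rightarrow> (real^'n \<Rightarrow> complex) \<Rightarrow> bool" where
  "has_fourier_multiplier A \<Omega> \<sigma> f g \<longleftrightarrow>
     g \<in> L2_space A \<Omega> \<and>
     (\<forall>\<kappa>\<in>dual_lattice A.
        fourier_coeff \<Omega> g \<kappa> = complex_of_real (\<sigma> \<kappa>) * fourier_coeff \<Omega> f \<kappa>)"

definition fourier_multiplier ::
  "real^'n^'n \<Rightarrow> (real^'n) set \<Rightarrow> (real^'n \<Rightarrow> real) \<Rightarrow>
   (real^'n \<Rightarrow> complex) \<Rightarrow> (real^'n \<Rightarrow> complex)" where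
  "fourier_multiplier A \<Omega> \<sigma> f = (SOME g. has_fourier_multiplier A \<Omega> \<sigma> f g)"

definition laplace_symbol :: "real^'n \<Rightarrow> real" where
  "laplace_symbol \<kappa> = - 4 * pi\<^sup>2 * (norm \<kappa>)\<^sup>2"

text \<open>The symbol of \<open>(I - \<Delta>)\<close> raised to the power \<open>\<gamma>/2\<close>.\<close>

definition bessel_symbol :: "real \<Rightarrow> real^'n \<Rightarrow> real" where
  "bessel_symbol \<gamma> \<kappa> = (1 - laplace_symbol \<kappa>) powr (\<gamma> / 2)"

definition HLip_space ::
  "real^'n^'n \<Rightarrow> (real^'n) set \<Rightarrow> real \<Rightarrow> real \<Rightarrow> (real^'n \<Rightarrow> complex) set" where
  "HLip_space A \<Omega> \<gamma> \<alpha> = {f \<in> Lip_space A \<Omega> \<alpha>.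
     \<exists>g\<in>Lip_space A \<Omega> \<alpha>. has_fourier_multiplier A \<Omega> (bessel_symbol \<gamma>) f g}"

definition HLip_norm ::
  "real^'n^'n \<Rightarrow> (real^'n) set \<Rightarrow> real \<Rightarrow> real \<Rightarrow> (real^'n \<Rightarrow> complex) \<Rightarrow> ennreal" where
  "HLip_norm A \<Omega> \<gamma> \<alpha> f =
     Lip_norm A \<Omega> \<alpha> (fourier_multiplier A \<Omega> (bessel_symbol \<gamma>) f)"

text \<open>Continuity of the inclusion map between normed spaces of functions. The norms are
  \<^typ>\<open>ennreal\<close>-valued, so their finiteness on the respective space is stated
  explicitly.\<close>

definition continuously_embedded ::
  "'a set \<Rightarrow> ('a \<Rightarrow> ennreal) \<Rightarrow> 'a set \<Rightarrow> ('a \<Rightarrow> ennreal) \<Rightarrow> bool" where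
  "continuously_embedded X nX Y nY \<longleftrightarrow>
     (\<forall>f\<in>X. nX f < \<infinity>) \<and> (\<forall>f\<in>Y. nY f < \<infinity>) \<and>
     X \<subseteq> Y \<and>
     (\<exists>C::real. \<forall>f\<in>X. nY f \<le> ennreal C * nX f)"

end

theory Submission
  imports Defs
begin

text \<open>Everything is read off from the Fourier coefficients \<open>c\<^sub>\<kappa>\<close> of \<open>f\<close>. By Parseval's identity,
  \<open>\<parallel>f(\<cdot>+h) - f\<parallel>\<^sup>2\<close> is the sum of \<open>\<bar>exp(2\<pi>i \<kappa>\<cdot>h) - 1\<bar>\<^sup>2 \<bar>c\<^sub>\<kappa>\<bar>\<^sup>2\<close>, and a dyadic
  decomposition of this sum shows (Titchmarsh) that for \<open>0 < \<alpha> < 1\<close> it is \<open>O(\<bar>h\<bar>\<^bsup>2\<alpha>\<^esup>)\<close> if and only if the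
  sum of \<open>\<bar>c\<^sub>\<kappa>\<bar>\<^sup>2\<close> over \<open>\<bar>\<kappa>\<bar> > N\<close> is \<open>O(N\<^bsup>-2\<alpha>\<^esup>)\<close>. On that range the multiplier has symbol at
  least \<open>N\<^bsup>\<gamma>\<^esup>\<close>, so it turns tail decay of order \<open>\<alpha>\<close> for \<open>(I - \<Delta>)\<^bsup>\<gamma>/2\<^esup> f\<close> into tail decay of
  order \<open>\<alpha> + \<gamma>\<close> for \<open>f\<close>; the embedding constant is \<open>1\<close>.

  Completeness of the exponentials in \<open>L\<^sup>2(\<Omega>)\<close> comes from the Stone--Weierstrass theorem on the
  torus, embedded in \<open>\<complex>\<^sup>d\<close>, and the approximation of measurable subsets of \<open>\<Omega>\<close> by compact ones.\<close>

subsection \<open>Lattices and fundamental domains\<close>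

text \<open>A fundamental domain is only a measurable set of representatives: it may be unbounded
  and topologically wild. Integrals over it are therefore compared with integrals over other sets by
  cutting along lattice translates; this yields finite measure and the invariance under x -> x + h
  on which the increments depend. Both halves of the equivalence between increments and tails are
  proved for finite sets of frequencies with one uniform constant, so that passing to infinite sums
  is left to Parseval and summability. The condition \<alpha> + \<gamma> < 1 enters where decay is
  turned back into an increment bound. With \<beta> = \<alpha> + \<gamma>, the low frequencies
  contribute |h|^2 times a sum of (2^j)^(2 - 2 \<beta>), and only a growing geometric series is
  controlled by its last term. \<open>HLip_norm\<close> is evaluated at a function picked by
  \<open>SOME\<close>, which may differ from the witness in \<open>HLip_space\<close>. The two share
  their coefficients, so norm estimates are made from coefficients alone.\<close>

lemma lattice_zero: "0 \<in> lattice A"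
  unfolding lattice_def by (rule image_eqI[of _ _ 0]) auto

lemma lattice_add: "x \<in> lattice A \<Longrightarrow> y \<in> lattice A \<Longrightarrow> x + y \<in> lattice A"
  unfolding lattice_def
  by (elim imageE, rule image_eqI[where x="u + v" for u v])
    (auto simp: matrix_vector_right_distrib)

lemma lattice_uminus: "x \<in> lattice A \<Longrightarrow> - x \<in> lattice A"
  unfolding lattice_def
  by (elim imageE, rule image_eqI[where x="- z" for z]) (auto simp: vec.neg)

lemma countable_lattice:
  fixes A :: "real^'n^'n"
  shows "countable (lattice A)"
proof -
  have "{z :: real^'n. \<forall>i. z $ i \<in> \<int>} = (\<lambda>f. \<chi> i. of_int (f i)) ` (UNIV :: ('n \<Rightarrow> int) set)"
  proof (intro set_eqI iffI)
    fix z :: "real^'n" assume "z \<in> {z. \<forall>i. z $ i \<in> \<int>}"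
    then have "z = (\<chi> i. of_int \<lfloor>z $ i\<rfloor>)"
      by (auto simp: vec_eq_iff)
    then show "z \<in> (\<lambda>f. \<chi> i. of_int (f i)) ` (UNIV :: ('n \<Rightarrow> int) set)"
      by (rule image_eqI[of _ _ "\<lambda>i. \<lfloor>z $ i\<rfloor>"]) auto
  qed auto
  then show ?thesis
    unfolding lattice_def by simp
qed

lemma closed_lattice:
  fixes A :: "real^'n^'n"
  assumes "invertible A"
  shows "closed (lattice A)"
proof -
  have "{z :: real^'n. \<forall>i. z $ i \<in> \<int>} = (\<Inter>i. (\<lambda>z. z $ i) -` \<int>)"
    by auto
  moreover have "closed ((\<lambda>z :: real^'n. z $ i) -` \<int>)" for i :: 'n
    by (intro continuous_closed_vimage closed_Ints continuous_intros)
  ultimately have "closed {z :: real^'n. \<forall>i. z $ i \<in> \<int>}"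
    by (simp add: closed_INT)
  moreover have "inj ((*v) A)"
    using assms by (simp add: invertible_left_inverse matrix_left_invertible_injective)
  ultimately show ?thesis
    unfolding lattice_def
    by (intro closed_injective_linear_image) auto
qed

lemma fundamental_domain_lebesgue: "fundamental_domain A \<Omega> \<Longrightarrow> \<Omega> \<in> sets lebesgue"
  by (simp add: fundamental_domain_def)

lemma fundamental_domain_cover:
  assumes "fundamental_domain A \<Omega>"
  obtains l where "l \<in> lattice A" "x - l \<in> \<Omega>"
proof -
  from assms obtain p where "fst p \<in> \<Omega>" "snd p \<in> lattice A" "x = fst p + snd p"
    unfolding fundamental_domain_def by blast
  then show thesis by (intro that[of "snd p"]) auto
qed

lemma fundamental_domain_unique:
  assumes "fundamental_domain A \<Omega>" "y + l \<in> \<Omega>" "y + l' \<in> \<Omega>" "l \<in> lattice A" "l' \<in> lattice A"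
  shows "l = l'"
proof -
  have "\<exists>!p. fst p \<in> \<Omega> \<and> snd p \<in> lattice A \<and> y = fst p + snd p"
    using assms(1) by (simp add: fundamental_domain_def)
  moreover have "y = fst (y + l, - l) + snd (y + l, - l)" "y = fst (y + l', - l') + snd (y + l', - l')"
    by auto
  ultimately have "(y + l, - l) = (y + l', - l')"
    using assms lattice_uminus by (metis fst_conv snd_conv)
  then show ?thesis by simp
qed

section \<open>Translation invariance of integrals of periodic functions\<close>

lemma lebesgue_shift:
  fixes h :: "'a::euclidean_space"
  shows measurable_lebesgue_shift: "(\<lambda>x. x + h) \<in> lebesgue \<rightarrow>\<^sub>M lebesgue"
    and distr_lebesgue_shift: "distr lebesgue lebesgue (\<lambda>x. x + h) = lebesgue"
proof -
  have eq: "(\<lambda>x. h + (\<Sum>j\<in>Basis. (1 * (x \<bullet> j)) *\<^sub>R j)) = (\<lambda>x. x + h)"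
    by (auto simp: euclidean_representation)
  show "(\<lambda>x. x + h) \<in> lebesgue \<rightarrow>\<^sub>M lebesgue"
    using lebesgue_affine_measurable[of "\<lambda>_. 1" h] unfolding eq by simp
  show "distr lebesgue lebesgue (\<lambda>x. x + h) = lebesgue"
    using lebesgue_affine_euclidean[of "\<lambda>_. 1" h] unfolding eq by (simp add: density_1)
qed

lemma nn_integral_lebesgue_shift:
  fixes h :: "'a::euclidean_space" and F :: "'a \<Rightarrow> ennreal"
  assumes "F \<in> borel_measurable lebesgue"
  shows "(\<integral>\<^sup>+x. F (x + h) \<partial>lebesgue) = (\<integral>\<^sup>+x. F x \<partial>lebesgue)"
  using nn_integral_distr[OF measurable_lebesgue_shift[of h], of F] assms
  by (simp add: distr_lebesgue_shift)

text \<open>Unfolding: with \<open>\<Omega>\<^sub>2\<close> covering and \<open>\<Omega>\<^sub>1\<close> packing, the integral over \<open>\<Omega>\<^sub>1\<close> is cut into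
  the pieces \<open>\<Omega>\<^sub>1 \<inter> (\<Omega>\<^sub>2 + l)\<close>, whose translates \<open>(\<Omega>\<^sub>1 - l) \<inter> \<Omega>\<^sub>2\<close> are disjoint.\<close>

lemma nn_integral_packing_le_covering:
  fixes F :: "real^'n \<Rightarrow> ennreal"
  assumes [measurable]: "\<Omega>\<^sub>1 \<in> sets lebesgue" "\<Omega>\<^sub>2 \<in> sets lebesgue" "F \<in> borel_measurable lebesgue"
    and periodic: "\<And>x l. l \<in> lattice A \<Longrightarrow> F (x + l) = F x"
    and cover: "\<And>x. \<exists>l\<in>lattice A. x - l \<in> \<Omega>\<^sub>2"
    and pack: "\<And>y l l'. l \<in> lattice A \<Longrightarrow> l' \<in> lattice A \<Longrightarrow> y + l \<in> \<Omega>\<^sub>1 \<Longrightarrow> y + l' \<in> \<Omega>\<^sub>1 \<Longrightarrow> l = l'"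
  shows "(\<integral>\<^sup>+x\<in>\<Omega>\<^sub>1. F x \<partial>lebesgue) \<le> (\<integral>\<^sup>+x\<in>\<Omega>\<^sub>2. F x \<partial>lebesgue)"
proof -
  let ?L = "count_space (lattice A)"
  have sh[measurable]: "(\<lambda>x. x + l) \<in> lebesgue \<rightarrow>\<^sub>M lebesgue" "(\<lambda>x. x - l) \<in> lebesgue \<rightarrow>\<^sub>M lebesgue" for l :: "real^'n"
    using measurable_lebesgue_shift[of l] measurable_lebesgue_shift[of "-l"] by auto
  have m1: "(\<lambda>x. indicator \<Omega>\<^sub>1 x * indicator \<Omega>\<^sub>2 (x - l) * F x) \<in> borel_measurable lebesgue" for l
    using measurable_compose[OF sh(2), of "indicator \<Omega>\<^sub>2" borel] by measurable
  have m2: "(\<lambda>x. indicator \<Omega>\<^sub>1 (x + l) * indicator \<Omega>\<^sub>2 x * F x) \<in> borel_measurable lebesgue" for l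
    using measurable_compose[OF sh(1), of "indicator \<Omega>\<^sub>1" borel] by measurable
  have ge1: "1 \<le> (\<integral>\<^sup>+l. indicator \<Omega>\<^sub>2 (x - l) \<partial>?L)" for x
  proof -
    obtain l where l: "l \<in> lattice A" "x - l \<in> \<Omega>\<^sub>2" using cover by blast
    have "1 = (\<integral>\<^sup>+l'. indicator {l} l' \<partial>?L)"
      using l by (subst nn_integral_indicator) auto
    also have "\<dots> \<le> (\<integral>\<^sup>+l. indicator \<Omega>\<^sub>2 (x - l) \<partial>?L)"
      using l by (intro nn_integral_mono) (auto simp: indicator_def)
    finally show ?thesis .
  qed
  have le1: "(\<integral>\<^sup>+l. indicator \<Omega>\<^sub>1 (y + l) \<partial>?L) \<le> 1" for y
  proof -
    obtain l where l: "{l\<in>lattice A. y + l \<in> \<Omega>\<^sub>1} \<subseteq> {l}"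
      using pack by blast
    have "(\<integral>\<^sup>+l. indicator \<Omega>\<^sub>1 (y + l) \<partial>?L) \<le> (\<integral>\<^sup>+l'. indicator ({l} \<inter> lattice A) l' \<partial>?L)"
      using l by (intro nn_integral_mono) (auto simp: indicator_def)
    also have "\<dots> = emeasure ?L ({l} \<inter> lattice A)"
      by (subst nn_integral_indicator) auto
    also have "\<dots> \<le> 1"
      by (subst emeasure_count_space) (auto simp: Int_insert_left)
    finally show ?thesis .
  qed
  have "(\<integral>\<^sup>+x\<in>\<Omega>\<^sub>1. F x \<partial>lebesgue)
      \<le> (\<integral>\<^sup>+x. (\<integral>\<^sup>+l. indicator \<Omega>\<^sub>1 x * indicator \<Omega>\<^sub>2 (x - l) * F x \<partial>?L) \<partial>lebesgue)"
  proof (rule nn_integral_mono)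
    fix x
    have "F x * indicator \<Omega>\<^sub>1 x = (indicator \<Omega>\<^sub>1 x * F x) * 1" by (simp add: mult.commute)
    also have "\<dots> \<le> (indicator \<Omega>\<^sub>1 x * F x) * (\<integral>\<^sup>+l. indicator \<Omega>\<^sub>2 (x - l) \<partial>?L)"
      by (intro mult_left_mono ge1) auto
    also have "\<dots> = (\<integral>\<^sup>+l. indicator \<Omega>\<^sub>1 x * indicator \<Omega>\<^sub>2 (x - l) * F x \<partial>?L)"
      by (subst nn_integral_cmult[symmetric]) (auto simp: mult_ac)
    finally show "F x * indicator \<Omega>\<^sub>1 x \<le> (\<integral>\<^sup>+l. indicator \<Omega>\<^sub>1 x * indicator \<Omega>\<^sub>2 (x - l) * F x \<partial>?L)" .
  qed
  also have "\<dots> = (\<integral>\<^sup>+l. (\<integral>\<^sup>+x. indicator \<Omega>\<^sub>1 x * indicator \<Omega>\<^sub>2 (x - l) * F x \<partial>lebesgue) \<partial>?L)"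
    by (intro nn_integral_count_space_nn_integral countable_lattice m1)
  also have "\<dots> = (\<integral>\<^sup>+l. (\<integral>\<^sup>+x. indicator \<Omega>\<^sub>1 (x + l) * indicator \<Omega>\<^sub>2 x * F x \<partial>lebesgue) \<partial>?L)"
  proof (rule nn_integral_cong)
    fix l assume "l \<in> space ?L"
    then show "(\<integral>\<^sup>+x. indicator \<Omega>\<^sub>1 x * indicator \<Omega>\<^sub>2 (x - l) * F x \<partial>lebesgue) =
        (\<integral>\<^sup>+x. indicator \<Omega>\<^sub>1 (x + l) * indicator \<Omega>\<^sub>2 x * F x \<partial>lebesgue)"
      using nn_integral_lebesgue_shift[OF m1, of l l] by (simp add: periodic)
  qed
  also have "\<dots> = (\<integral>\<^sup>+x. (\<integral>\<^sup>+l. indicator \<Omega>\<^sub>1 (x + l) * indicator \<Omega>\<^sub>2 x * F x \<partial>?L) \<partial>lebesgue)"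
    by (intro nn_integral_count_space_nn_integral[symmetric] countable_lattice m2)
  also have "\<dots> \<le> (\<integral>\<^sup>+x\<in>\<Omega>\<^sub>2. F x \<partial>lebesgue)"
  proof (rule nn_integral_mono)
    fix x
    have "(\<integral>\<^sup>+l. indicator \<Omega>\<^sub>1 (x + l) * indicator \<Omega>\<^sub>2 x * F x \<partial>?L) =
        (indicator \<Omega>\<^sub>2 x * F x) * (\<integral>\<^sup>+l. indicator \<Omega>\<^sub>1 (x + l) \<partial>?L)"
      by (subst nn_integral_cmult[symmetric]) (auto simp: mult_ac)
    also have "\<dots> \<le> (indicator \<Omega>\<^sub>2 x * F x) * 1"
      by (intro mult_left_mono le1) auto
    finally show "(\<integral>\<^sup>+l. indicator \<Omega>\<^sub>1 (x + l) * indicator \<Omega>\<^sub>2 x * F x \<partial>?L) \<le> F x * indicator \<Omega>\<^sub>2 x"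
      by (simp add: mult.commute)
  qed
  finally show ?thesis .
qed

text \<open>The translate \<Omega> + h still covers and still packs, so the packing inequality holds
  between \<Omega> and \<Omega> + h in both directions. This handles \<open>F (x + h)\<close>
  although x + h may leave \<Omega>.\<close>

lemma nn_integral_fundamental_domain_shift:
  fixes F :: "real^'n \<Rightarrow> ennreal"
  assumes fd: "fundamental_domain A \<Omega>"
    and F: "F \<in> borel_measurable lebesgue" "\<And>x l. l \<in> lattice A \<Longrightarrow> F (x + l) = F x"
  shows "(\<integral>\<^sup>+x\<in>\<Omega>. F (x + h) \<partial>lebesgue) = (\<integral>\<^sup>+x\<in>\<Omega>. F x \<partial>lebesgue)"
proof -
  note [measurable] = fundamental_domain_lebesgue[OF fd] F(1)
  define \<Omega>' where "\<Omega>' = (\<lambda>x. x - h) -` \<Omega>"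
  have m[measurable]: "(\<lambda>x. x - h) \<in> lebesgue \<rightarrow>\<^sub>M lebesgue"
    using measurable_lebesgue_shift[of "-h"] by simp
  have \<Omega>'[measurable]: "\<Omega>' \<in> sets lebesgue"
    using measurable_sets[OF m, of \<Omega>] unfolding \<Omega>'_def by simp
  have "(\<integral>\<^sup>+x\<in>\<Omega>. F (x + h) \<partial>lebesgue) = (\<integral>\<^sup>+x\<in>\<Omega>'. F x \<partial>lebesgue)"
    using nn_integral_lebesgue_shift[of "\<lambda>x. F x * indicator \<Omega>' x" h] F
    by (simp add: \<Omega>'_def indicator_def)
  also have "\<dots> = (\<integral>\<^sup>+x\<in>\<Omega>. F x \<partial>lebesgue)"
  proof (rule antisym; rule nn_integral_packing_le_covering[where A=A])
    fix x
    show "\<exists>l\<in>lattice A. x - l \<in> \<Omega>"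
      using fundamental_domain_cover[OF fd] by blast
    obtain l where "l \<in> lattice A" "x - h - l \<in> \<Omega>"
      using fundamental_domain_cover[OF fd] by blast
    then show "\<exists>l\<in>lattice A. x - l \<in> \<Omega>'"
      by (auto simp: \<Omega>'_def algebra_simps)
  next
    fix y l l' assume l: "l \<in> lattice A" "l' \<in> lattice A"
    show "y + l \<in> \<Omega> \<Longrightarrow> y + l' \<in> \<Omega> \<Longrightarrow> l = l'"
      using fundamental_domain_unique[OF fd] l by blast
    show "y + l \<in> \<Omega>' \<Longrightarrow> y + l' \<in> \<Omega>' \<Longrightarrow> l = l'"
      using fundamental_domain_unique[OF fd, of "y - h" l l'] l
      by (simp add: \<Omega>'_def algebra_simps)
  qed (use F in auto)
  finally show ?thesis .
qed

section \<open>Size of a fundamental domain and measurability of periodic extensions\<close>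

lemma matrix_inv_inverse:
  fixes A :: "'a::semiring_1^'n^'n"
  assumes "invertible A"
  shows "A ** matrix_inv A = mat 1" "matrix_inv A ** A = mat 1"
  using assms someI_ex[of "\<lambda>A'. A ** A' = mat 1 \<and> A' ** A = mat 1"]
  unfolding invertible_def matrix_inv_def by auto

text \<open>Q is the closed parallelepiped spanned by the columns of A; its translates share faces,
  which covering permits. Compactness is what bounds the measure of \<Omega> and makes the image of
  the torus map compact.\<close>

lemma compact_covers:
  assumes "invertible A"
  obtains Q where "compact Q" "\<And>x. \<exists>l\<in>lattice A. x - l \<in> Q"
proof
  define Q where "Q = (*v) A ` cbox 0 1"
  show "compact Q"
    unfolding Q_def by (intro compact_continuous_image linear_continuous_on) auto
  fix x
  define y where "y = matrix_inv A *v x"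
  \<comment> \<open>Rounding the lattice coordinates of x down leaves fractional parts in [0,
    1).\<close>
  define w :: "real^'a" where "w = (\<chi> i. of_int \<lfloor>y $ i\<rfloor>)"
  have x: "x = A *v y"
    using assms by (simp add: y_def matrix_vector_mul_assoc matrix_inv_inverse)
  have "x - A *v w = A *v (y - w)"
    by (simp add: x matrix_vector_mult_diff_distrib)
  moreover have "y - w \<in> cbox 0 1"
    by (auto simp: mem_box_cart w_def; linarith)
  moreover have "A *v w \<in> lattice A"
    unfolding lattice_def by (intro imageI) (auto simp: w_def)
  ultimately show "\<exists>l\<in>lattice A. x - l \<in> Q"
    unfolding Q_def by (metis image_eqI)
qed

text \<open>The measure is finite because \<Omega> packs while a compact set covers; it is positive
  because countably many translates of a null set cannot fill the space.\<close>

lemma fundamental_domain_measure: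
  assumes inv: "invertible A" and fd: "fundamental_domain A \<Omega>"
  shows fundamental_domain_lmeasurable: "\<Omega> \<in> lmeasurable"
    and fundamental_domain_measure_pos: "0 < measure lebesgue \<Omega>"
proof -
  note [measurable] = fundamental_domain_lebesgue[OF fd]
  obtain Q where Q: "compact Q" "\<And>x. \<exists>l\<in>lattice A. x - l \<in> Q"
    using compact_covers[OF inv] by blast
  have Qm: "Q \<in> lmeasurable" using Q(1) by (rule lmeasurable_compact)
  have "emeasure lebesgue \<Omega> = (\<integral>\<^sup>+x\<in>\<Omega>. 1 \<partial>lebesgue)"
    by (simp del: emeasure_completion)
  also have "\<dots> \<le> (\<integral>\<^sup>+x\<in>Q. 1 \<partial>lebesgue)"
    using Q fundamental_domain_unique[OF fd] Qm
    by (intro nn_integral_packing_le_covering[where A=A]) auto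
  also have "\<dots> = emeasure lebesgue Q"
    using Qm by (simp add: fmeasurable_def del: emeasure_completion)
  also have "\<dots> < \<infinity>" using Qm by (simp add: fmeasurable_def del: emeasure_completion)
  finally show lm: "\<Omega> \<in> lmeasurable" by (simp add: fmeasurable_def)
  have "\<not> negligible \<Omega>"
  proof
    assume "negligible \<Omega>"
    then have "negligible (\<Union>l\<in>lattice A. (+) l ` \<Omega>)"
      by (intro negligible_countable_Union) (auto simp: countable_lattice negligible_translation)
    moreover have "(\<Union>l\<in>lattice A. (+) l ` \<Omega>) = UNIV"
    proof (intro set_eqI iffI UNIV_I)
      fix x
      obtain l where "l \<in> lattice A" "x - l \<in> \<Omega>"
        using fundamental_domain_cover[OF fd] by blast
      then show "x \<in> (\<Union>l\<in>lattice A. (+) l ` \<Omega>)"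
        by (intro UN_I[of l] image_eqI[of _ _ "x - l"]) auto
    qed
    ultimately show False
      using non_negligible_UNIV by metis
  qed
  then show "0 < measure lebesgue \<Omega>"
    using lm by (metis negligible_iff_measure zero_less_measure_iff)
qed

text \<open>Each preimage is the union of the lattice translates of its part inside \<Omega>, and
  the lattice is countable.\<close>

lemma borel_measurable_periodic_extension:
  fixes f :: "real^'n \<Rightarrow> 'b::topological_space"
  assumes fd: "fundamental_domain A \<Omega>"
    and f: "f \<in> borel_measurable (lebesgue_on \<Omega>)" "\<And>x l. l \<in> lattice A \<Longrightarrow> f (x + l) = f x"
  shows "f \<in> borel_measurable lebesgue"
proof (rule measurableI)
  fix B :: "'b set" assume B: "B \<in> sets borel"
  have S: "f -` B \<inter> \<Omega> \<in> sets lebesgue"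
    using measurable_sets[OF f(1) B] fundamental_domain_lebesgue[OF fd]
    by (auto simp: sets_restrict_space_iff)
  have "f -` B = (\<Union>l\<in>lattice A. (+) l ` (f -` B \<inter> \<Omega>))"
  proof (intro set_eqI iffI)
    fix x assume x: "x \<in> f -` B"
    obtain l where l: "l \<in> lattice A" "x - l \<in> \<Omega>"
      using fundamental_domain_cover[OF fd] by blast
    then have "f (x - l) = f x" using f(2)[of l "x - l"] by simp
    then show "x \<in> (\<Union>l\<in>lattice A. (+) l ` (f -` B \<inter> \<Omega>))"
      using l x by (intro UN_I[of l] image_eqI[of _ _ "x - l"]) auto
  next
    fix x assume "x \<in> (\<Union>l\<in>lattice A. (+) l ` (f -` B \<inter> \<Omega>))"
    then obtain l y where "l \<in> lattice A" "y \<in> f -` B" "x = y + l" by (auto simp: add.commute)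
    then show "x \<in> f -` B" using f(2) by auto
  qed
  also have "\<dots> \<in> sets lebesgue"
    by (intro sets.countable_UN' countable_lattice) (auto intro: lebesgue_sets_translation S)
  finally show "f -` B \<inter> space lebesgue \<in> sets lebesgue" by simp
qed auto

subsection \<open>Characters and trigonometric polynomials\<close>

definition chi :: "real^'n \<Rightarrow> real^'n \<Rightarrow> complex" where
  "chi \<kappa> x = cis (2 * pi * (\<kappa> \<bullet> x))"

lemma norm_chi [simp]: "cmod (chi \<kappa> x) = 1"
  by (simp add: chi_def)

lemma chi_zero [simp]: "chi 0 x = 1"
  by (simp add: chi_def)

lemma chi_add_right: "chi \<kappa> (x + y) = chi \<kappa> x * chi \<kappa> y"
  by (simp add: chi_def inner_add_right ring_distribs cis_mult)

lemma chi_add_left: "chi (\<kappa> + \<mu>) x = chi \<kappa> x * chi \<mu> x"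
  by (simp add: chi_def inner_add_left ring_distribs cis_mult)

lemma cnj_chi: "cnj (chi \<kappa> x) = chi (- \<kappa>) x"
  by (simp add: chi_def cis_cnj)

lemma chi_cnj_chi [simp]: "chi \<kappa> x * cnj (chi \<kappa> x) = 1" "cnj (chi \<kappa> x) * chi \<kappa> x = 1"
  using complex_norm_square[of "chi \<kappa> x"] by (simp_all add: mult.commute)

lemma continuous_on_chi [continuous_intros]: "continuous_on S (chi \<kappa>)"
  unfolding chi_def by (intro continuous_intros)

lemma borel_measurable_lebesgue_on_continuous:
  fixes f :: "'a::euclidean_space \<Rightarrow> 'b::topological_space"
  assumes "continuous_on UNIV f"
  shows "f \<in> borel_measurable (lebesgue_on \<Omega>)"
  using borel_measurable_continuous_onI[OF assms]
  by (intro measurable_restrict_space1 measurable_completion) simp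

lemma borel_measurable_chi [measurable]: "chi \<kappa> \<in> borel_measurable (lebesgue_on \<Omega>)"
  by (intro borel_measurable_lebesgue_on_continuous continuous_intros)

lemma cis_eq_1_iff: "cis (2 * pi * t) = 1 \<longleftrightarrow> t \<in> \<int>"
proof
  assume "cis (2 * pi * t) = 1"
  then have "cos (2 * pi * t) = 1" by (metis cis.sel(1) one_complex.sel(1))
  then obtain n :: int where "2 * pi * t = of_int n * 2 * pi" by (auto simp: cos_one_2pi_int)
  then have "t = of_int n" by (simp add: field_simps)
  then show "t \<in> \<int>" by simp
qed auto

lemma invertible_transpose:
  fixes A :: "real^'n^'n"
  assumes "invertible A"
  shows "invertible (transpose A)"
proof -
  obtain B where "A ** B = mat 1" "B ** A = mat 1"
    using assms unfolding invertible_def by blast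
  then have "transpose B ** transpose A = mat 1" "transpose A ** transpose B = mat 1"
    by (simp_all add: matrix_transpose_mul[symmetric] transpose_mat)
  then show ?thesis unfolding invertible_def by blast
qed

text \<open>Moving A across the inner product leaves the inner product of two integer
  vectors.\<close>

lemma dual_lattice_inner:
  fixes A :: "real^'n^'n"
  assumes inv: "invertible A" and "\<kappa> \<in> dual_lattice A" "l \<in> lattice A"
  shows "\<kappa> \<bullet> l \<in> \<int>"
proof -
  obtain z where z: "\<forall>i. z $ i \<in> \<int>" "\<kappa> = matrix_inv (transpose A) *v z"
    using assms(2) unfolding dual_lattice_def lattice_def by auto
  obtain w where w: "\<forall>i. w $ i \<in> \<int>" "l = A *v w"
    using assms(3) unfolding lattice_def by auto
  have "\<kappa> \<bullet> l = (transpose A *v \<kappa>) \<bullet> w"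
    by (simp add: w(2) dot_lmul_matrix[symmetric])
  also have "transpose A *v \<kappa> = z"
    using inv by (simp add: z(2) matrix_vector_mul_assoc matrix_inv_inverse invertible_transpose del: transpose_matrix_vector)
  also have "z \<bullet> w \<in> \<int>"
    using z(1) w(1) by (auto simp: inner_vec_def)
  finally show ?thesis .
qed

lemma chi_periodic:
  assumes "invertible A" "\<kappa> \<in> dual_lattice A" "l \<in> lattice A"
  shows "chi \<kappa> (x + l) = chi \<kappa> x"
  using dual_lattice_inner[OF assms] cis_eq_1_iff[of "\<kappa> \<bullet> l"]
  by (simp add: chi_add_right) (simp add: chi_def)

section \<open>The torus as a subset of complex space\<close>

definition dual_basis :: "real^'n^'n \<Rightarrow> 'n \<Rightarrow> real^'n" where
  "dual_basis A j = matrix_inv (transpose A) *v axis j 1"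

lemma dual_basis_mem: "dual_basis A j \<in> dual_lattice A"
  unfolding dual_basis_def dual_lattice_def lattice_def
  by (intro imageI) (auto simp: axis_def)

lemma dual_basis_inner:
  assumes "invertible A"
  shows "dual_basis A j \<bullet> (A *v y) = y $ j"
proof -
  have "dual_basis A j \<bullet> (A *v y) = (transpose A *v dual_basis A j) \<bullet> y"
    by (simp add: dot_lmul_matrix[symmetric])
  also have "transpose A *v dual_basis A j = axis j 1"
    using assms by (simp add: dual_basis_def matrix_vector_mul_assoc matrix_inv_inverse invertible_transpose del: transpose_matrix_vector)
  finally show ?thesis by (simp add: inner_axis')
qed

text \<open>For x = A y the j-th coordinate is exp(2 pi i y_j), since \<open>dual_basis A j\<close>
  reads off y_j. Real polynomials in these coordinates pull back to trigonometric
  polynomials.\<close>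

definition torus_map :: "real^'n^'n \<Rightarrow> real^'n \<Rightarrow> complex^'n" where
  "torus_map A x = (\<chi> j. chi (dual_basis A j) x)"

text \<open>Equal images force every lattice coordinate of x - y to be an integer. The fibres are
  thus exactly the lattice cosets, so periodic functions factor through the map.\<close>

lemma torus_map_eq_iff:
  assumes inv: "invertible A"
  shows "torus_map A x = torus_map A y \<longleftrightarrow> x - y \<in> lattice A"
proof
  assume "torus_map A x = torus_map A y"
  then have eq: "chi (dual_basis A j) x = chi (dual_basis A j) y" for j
    by (auto simp: torus_map_def vec_eq_iff)
  define u where "u = matrix_inv A *v (x - y)"
  have u: "x - y = A *v u"
    using inv by (simp add: u_def matrix_vector_mul_assoc matrix_inv_inverse)
  have "u $ j \<in> \<int>" for j
  proof -
    have "chi (dual_basis A j) (x - y) * chi (dual_basis A j) y = 1 * chi (dual_basis A j) y"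
      using eq[of j] chi_add_right[of "dual_basis A j" "x - y" y] by simp
    then have "chi (dual_basis A j) (x - y) = 1"
      by (metis mult_cancel_right norm_chi norm_zero zero_neq_one)
    then have "dual_basis A j \<bullet> (x - y) \<in> \<int>"
      by (simp add: chi_def cis_eq_1_iff)
    then show ?thesis by (simp add: u dual_basis_inner[OF inv])
  qed
  then show "x - y \<in> lattice A"
    unfolding lattice_def u by auto
next
  assume "x - y \<in> lattice A"
  then show "torus_map A x = torus_map A y"
    using chi_periodic[OF inv dual_basis_mem, of "x - y" _ y]
    by (simp add: torus_map_def vec_eq_iff)
qed

section \<open>The algebra of trigonometric polynomials and uniform approximation\<close>

lemma dual_lattice_add: "\<kappa> \<in> dual_lattice A \<Longrightarrow> \<mu> \<in> dual_lattice A \<Longrightarrow> \<kappa> + \<mu> \<in> dual_lattice A"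
  and dual_lattice_uminus: "\<kappa> \<in> dual_lattice A \<Longrightarrow> - \<kappa> \<in> dual_lattice A"
  and dual_lattice_zero: "0 \<in> dual_lattice A"
  by (simp_all add: dual_lattice_def lattice_add lattice_uminus lattice_zero)

text \<open>The inductive form gives closure under products and conjugation by rule induction. The
  explicit finite sum is recovered in \<open>trig_poly_expansion\<close>, where coefficients have to
  be compared.\<close>

inductive_set trig_poly :: "real^'n^'n \<Rightarrow> (real^'n \<Rightarrow> complex) set" for A where
  chi: "\<kappa> \<in> dual_lattice A \<Longrightarrow> chi \<kappa> \<in> trig_poly A"
| add: "p \<in> trig_poly A \<Longrightarrow> q \<in> trig_poly A \<Longrightarrow> (\<lambda>x. p x + q x) \<in> trig_poly A"
| scale: "p \<in> trig_poly A \<Longrightarrow> (\<lambda>x. c * p x) \<in> trig_poly A"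

lemma trig_poly_const: "(\<lambda>x. c) \<in> trig_poly A"
  using trig_poly.scale[OF trig_poly.chi[OF dual_lattice_zero], of c] by simp

lemma trig_poly_mult_chi:
  assumes "\<kappa> \<in> dual_lattice A" "p \<in> trig_poly A"
  shows "(\<lambda>x. chi \<kappa> x * p x) \<in> trig_poly A"
  using assms(2)
proof induction
  case (chi \<mu>)
  then show ?case
    using trig_poly.chi[OF dual_lattice_add[OF assms(1) chi]]
    by (subst (asm) fun_eq_iff[THEN iffD2, of "chi (\<kappa> + \<mu>)" "\<lambda>x. chi \<kappa> x * chi \<mu> x"])
      (auto simp: chi_add_left)
next
  case (add p q)
  then show ?case using trig_poly.add[OF add.IH] by (simp add: algebra_simps)
next
  case (scale p c)
  then show ?case using trig_poly.scale[OF scale.IH, of c] by (simp add: algebra_simps)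
qed

lemma trig_poly_mult:
  assumes "p \<in> trig_poly A" "q \<in> trig_poly A"
  shows "(\<lambda>x. p x * q x) \<in> trig_poly A"
  using assms(1)
proof induction
  case (chi \<kappa>)
  then show ?case using trig_poly_mult_chi assms(2) by blast
next
  case (add p p')
  then show ?case using trig_poly.add[OF add.IH] by (simp add: algebra_simps)
next
  case (scale p c)
  then show ?case using trig_poly.scale[OF scale.IH, of c] by (simp add: algebra_simps)
qed

lemma trig_poly_cnj:
  assumes "p \<in> trig_poly A"
  shows "(\<lambda>x. cnj (p x)) \<in> trig_poly A"
  using assms
proof induction
  case (chi \<kappa>)
  then show ?case
    using trig_poly.chi[OF dual_lattice_uminus[OF chi]] by (simp add: cnj_chi)
next
  case (add p p')
  then show ?case using trig_poly.add[OF add.IH] by simp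
next
  case (scale p c)
  then show ?case using trig_poly.scale[OF scale.IH, of "cnj c"] by simp
qed

lemma trig_poly_Re:
  assumes "p \<in> trig_poly A"
  shows "(\<lambda>x. complex_of_real (Re (p x))) \<in> trig_poly A"
proof -
  have "(\<lambda>x. complex_of_real (Re (p x))) = (\<lambda>x. (1/2) * (p x + cnj (p x)))"
    by (simp add: complex_eq_iff fun_eq_iff)
  then show ?thesis
    using trig_poly.scale[OF trig_poly.add[OF assms trig_poly_cnj[OF assms]], of "1/2"] by metis
qed

lemma trig_poly_sum:
  assumes "finite I" "\<And>i. i \<in> I \<Longrightarrow> p i \<in> trig_poly A"
  shows "(\<lambda>x. \<Sum>i\<in>I. p i x) \<in> trig_poly A"
  using assms
proof (induction I rule: finite_induct)
  case empty
  then show ?case using trig_poly_const[of 0] by simp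
next
  case (insert i I)
  then have "(\<lambda>x. p i x + (\<Sum>i\<in>I. p i x)) \<in> trig_poly A"
    by (intro trig_poly.add) auto
  then show ?case using insert by simp
qed

lemma trig_poly_expansion:
  assumes "p \<in> trig_poly A"
  obtains F c where "finite F" "F \<subseteq> dual_lattice A" "p = (\<lambda>x. \<Sum>\<kappa>\<in>F. c \<kappa> * chi \<kappa> x)"
proof -
  have "\<exists>F c. finite F \<and> F \<subseteq> dual_lattice A \<and> p = (\<lambda>x. \<Sum>\<kappa>\<in>F. c \<kappa> * chi \<kappa> x)"
    using assms
  proof induction
    case (chi \<kappa>)
    then show ?case by (intro exI[of _ "{\<kappa>}"] exI[of _ "\<lambda>_. 1"]) auto
  next
    case (add p q)
    then obtain F c G d where F: "finite F" "F \<subseteq> dual_lattice A" "p = (\<lambda>x. \<Sum>\<kappa>\<in>F. c \<kappa> * chi \<kappa> x)"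
      and G: "finite G" "G \<subseteq> dual_lattice A" "q = (\<lambda>x. \<Sum>\<kappa>\<in>G. d \<kappa> * chi \<kappa> x)"
      by blast
    \<comment> \<open>Extension by 0 lets both sums run over the union, also where F and G
      overlap.\<close>
    define c' where "c' \<kappa> = (if \<kappa> \<in> F then c \<kappa> else 0)" for \<kappa>
    define d' where "d' \<kappa> = (if \<kappa> \<in> G then d \<kappa> else 0)" for \<kappa>
    have "p x + q x = (\<Sum>\<kappa>\<in>F \<union> G. (c' \<kappa> + d' \<kappa>) * chi \<kappa> x)" for x
    proof -
      have "p x = (\<Sum>\<kappa>\<in>F \<union> G. c' \<kappa> * chi \<kappa> x)"
        unfolding F(3) c'_def using F(1) G(1) by (intro sum.mono_neutral_cong_left) auto
      moreover have "q x = (\<Sum>\<kappa>\<in>F \<union> G. d' \<kappa> * chi \<kappa> x)"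
        unfolding G(3) d'_def using F(1) G(1) by (intro sum.mono_neutral_cong_left) auto
      ultimately show ?thesis by (simp add: sum.distrib ring_distribs)
    qed
    then show ?case
      using F G by (intro exI[of _ "F \<union> G"] exI[of _ "\<lambda>\<kappa>. c' \<kappa> + d' \<kappa>"]) auto
  next
    case (scale p c)
    then obtain F d where F: "finite F" "F \<subseteq> dual_lattice A" "p = (\<lambda>x. \<Sum>\<kappa>\<in>F. d \<kappa> * chi \<kappa> x)"
      by blast
    then show ?case
      by (intro exI[of _ F] exI[of _ "\<lambda>\<kappa>. c * d \<kappa>"]) (auto simp: sum_distrib_left mult.assoc)
  qed
  then show thesis using that by blast
qed

lemma continuous_on_trig_poly:
  "p \<in> trig_poly A \<Longrightarrow> continuous_on S p"
  by (induction rule: trig_poly.induct) (auto intro!: continuous_intros)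

text \<open>Real polynomials are generated by constants and real-linear functionals, and the latter
  are combinations of real and imaginary parts of coordinates. Closure under conjugation brings
  these parts into the algebra.\<close>

lemma trig_poly_real_polynomial_function:
  fixes A :: "real^'n^'n"
  assumes "real_polynomial_function g"
  shows "(\<lambda>x. complex_of_real (g (torus_map A x))) \<in> trig_poly A"
  using assms
proof induction
  case (linear g)
  then interpret bounded_linear g .
  have z: "z = (\<Sum>j\<in>UNIV. Re (z $ j) *\<^sub>R axis j 1 + Im (z $ j) *\<^sub>R axis j \<i>)" for z :: "complex^'n"
    by (simp add: vec_eq_iff axis_def if_distrib complex_eq_iff cong: if_cong)
  have g: "g z = (\<Sum>j\<in>UNIV. Re (z $ j) * g (axis j 1) + Im (z $ j) * g (axis j \<i>))" for z
    by (subst z) (simp add: sum add scale)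
  have coord: "chi (dual_basis A j) \<in> trig_poly A" for j
    by (intro trig_poly.chi dual_basis_mem)
  have "(\<lambda>x. complex_of_real (Re (chi (dual_basis A j) x)) * c) \<in> trig_poly A" for j c
    by (intro trig_poly_mult trig_poly_Re coord trig_poly_const)
  \<comment> \<open>Im z = Re (- \<i> z) reduces this to the real part.\<close>
  moreover have "(\<lambda>x. complex_of_real (Im (chi (dual_basis A j) x)) * c) \<in> trig_poly A" for j c
    using trig_poly_mult[OF trig_poly_Re[OF trig_poly.scale[OF coord[of j], of "- \<i>"]] trig_poly_const[of c]]
    by simp
  ultimately have "(\<lambda>x. complex_of_real (Re (chi (dual_basis A j) x)) * c +
      complex_of_real (Im (chi (dual_basis A j) x)) * d) \<in> trig_poly A" for j c d
    by (intro trig_poly.add)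
  then have "(\<lambda>x. \<Sum>j\<in>UNIV. complex_of_real (Re (chi (dual_basis A j) x)) * complex_of_real (g (axis j 1)) +
      complex_of_real (Im (chi (dual_basis A j) x)) * complex_of_real (g (axis j \<i>))) \<in> trig_poly A"
    by (intro trig_poly_sum) auto
  then show ?case
    by (subst g) (simp add: torus_map_def)
next
  case (const c)
  then show ?case by (rule trig_poly_const)
next
  case (add f g)
  then show ?case using trig_poly.add[OF add.IH] by simp
next
  case (mult f g)
  then show ?case using trig_poly_mult[OF mult.IH] by simp
qed

lemma trig_poly_uniform_approx:
  fixes A :: "real^'n^'n" and \<phi> :: "real^'n \<Rightarrow> real"
  assumes inv: "invertible A" and \<phi>: "continuous_on UNIV \<phi>"
    and periodic: "\<And>x l. l \<in> lattice A \<Longrightarrow> \<phi> (x + l) = \<phi> x" and "0 < e"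
  obtains p where "p \<in> trig_poly A" "\<And>x. cmod (complex_of_real (\<phi> x) - p x) < e"
proof -
  let ?E = "torus_map A"
  obtain Q where Q: "compact Q" "\<And>x. \<exists>l\<in>lattice A. x - l \<in> Q"
    using compact_covers[OF inv] by blast
  \<comment> \<open>Any preimage will do: two of them differ by a lattice vector, a period of
    \<phi>.\<close>
  define F where "F z = \<phi> (SOME x. ?E x = z)" for z
  have F: "F (?E x) = \<phi> x" for x
  proof -
    have "?E (SOME y. ?E y = ?E x) = ?E x" by (rule someI) auto
    then have "(SOME y. ?E y = ?E x) - x \<in> lattice A" by (simp add: torus_map_eq_iff[OF inv])
    then show ?thesis unfolding F_def using periodic[of "(SOME y. ?E y = ?E x) - x" x] by simp
  qed
  have range: "?E x \<in> ?E ` Q" for x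
  proof -
    obtain l where l: "l \<in> lattice A" "x - l \<in> Q" using Q by blast
    then have "?E x = ?E (x - l)" by (simp add: torus_map_eq_iff[OF inv])
    then show ?thesis using l by blast
  qed
  have cE: "continuous_on S ?E" for S
    unfolding torus_map_def by (intro continuous_intros)
  have cS: "compact (?E ` Q)"
    by (intro compact_continuous_image cE Q)
  \<comment> \<open>The torus map is closed on the compact set Q, so it acts as a quotient map:
    preimages of closed sets under F are images of compact sets.\<close>
  have "continuous_on (?E ` Q) F"
    unfolding continuous_on_closed_vimage[OF compact_imp_closed[OF cS]]
  proof (intro allI impI)
    fix B :: "real set" assume "closed B"
    then have "closed (\<phi> -` B)"
      using \<phi> by (simp add: continuous_on_closed_vimage)
    then have "compact (?E ` (Q \<inter> \<phi> -` B))"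
      by (intro compact_continuous_image cE compact_Int_closed Q)
    moreover have "F -` B \<inter> ?E ` Q = ?E ` (Q \<inter> \<phi> -` B)"
      by (auto simp: F)
    ultimately show "closed (F -` B \<inter> ?E ` Q)"
      by (simp add: compact_imp_closed)
  qed
  then obtain g where g: "real_polynomial_function g" "\<And>z. z \<in> ?E ` Q \<Longrightarrow> \<bar>F z - g z\<bar> < e"
    using Stone_Weierstrass_real_polynomial_function[OF cS _ \<open>0 < e\<close>] by blast
  show thesis
  proof
    show "(\<lambda>x. complex_of_real (g (?E x))) \<in> trig_poly A"
      by (rule trig_poly_real_polynomial_function[OF g(1)])
    show "cmod (complex_of_real (\<phi> x) - complex_of_real (g (?E x))) < e" for x
      using g(2)[OF range, of x] unfolding F by (metis norm_of_real of_real_diff)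
  qed
qed

subsection \<open>Parseval's identity\<close>

locale lattice_domain =
  fixes A :: "real^'n^'n" and \<Omega> :: "(real^'n) set"
  assumes inv: "invertible A" and fd: "fundamental_domain A \<Omega>"
begin

abbreviation M where "M \<equiv> lebesgue_on \<Omega>"
abbreviation m where "m \<equiv> measure lebesgue \<Omega>"
abbreviation fc where "fc \<equiv> fourier_coeff \<Omega>"

lemma \<Omega>_sets [measurable]: "\<Omega> \<in> sets lebesgue"
  by (rule fundamental_domain_lebesgue[OF fd])

lemma m_pos: "0 < m"
  by (rule fundamental_domain_measure_pos[OF inv fd])

lemma measure_space_M: "measure M \<Omega> = m"
  by (simp add: measure_restrict_space)

sublocale finite_measure M
  using fundamental_domain_lmeasurable[OF inv fd]
  by (intro finite_measureI) (simp add: emeasure_restrict_space fmeasurable_def)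

section \<open>Shift invariance of integrals over \<Omega>\<close>

definition periodic :: "(real^'n \<Rightarrow> 'b) \<Rightarrow> bool" where
  "periodic f \<longleftrightarrow> (\<forall>x. \<forall>l\<in>lattice A. f (x + l) = f x)"

lemma periodicD: "periodic f \<Longrightarrow> l \<in> lattice A \<Longrightarrow> f (x + l) = f x"
  by (simp add: periodic_def)

lemma periodic_chi: "\<kappa> \<in> dual_lattice A \<Longrightarrow> periodic (chi \<kappa>)"
  using chi_periodic[OF inv] by (simp add: periodic_def)

lemma borel_measurable_lebesgue_periodic:
  fixes f :: "real^'n \<Rightarrow> 'b::topological_space"
  shows "periodic f \<Longrightarrow> f \<in> borel_measurable M \<Longrightarrow> f \<in> borel_measurable lebesgue"
  by (rule borel_measurable_periodic_extension[OF fd _ periodicD])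

lemma borel_measurable_shift:
  fixes f :: "real^'n \<Rightarrow> 'b::topological_space"
  assumes "periodic f" "f \<in> borel_measurable M"
  shows "(\<lambda>x. f (x + h)) \<in> borel_measurable M"
  using borel_measurable_lebesgue_periodic[OF assms]
  by (intro measurable_restrict_space1 measurable_compose[OF measurable_lebesgue_shift])

lemma nn_integral_shift:
  fixes F :: "real^'n \<Rightarrow> ennreal"
  assumes "periodic F" "F \<in> borel_measurable M"
  shows "(\<integral>\<^sup>+x. F (x + h) \<partial>M) = (\<integral>\<^sup>+x. F x \<partial>M)"
  using nn_integral_fundamental_domain_shift[OF fd borel_measurable_lebesgue_periodic[OF assms] periodicD[OF assms(1)]]
  by (simp add: nn_integral_restrict_space)

lemma integrable_shift:
  fixes f :: "real^'n \<Rightarrow> 'b::{banach, second_countable_topology}"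
  assumes "periodic f" "integrable M f"
  shows "integrable M (\<lambda>x. f (x + h))"
proof (rule integrableI_bounded)
  show "(\<lambda>x. f (x + h)) \<in> borel_measurable M"
    using assms by (intro borel_measurable_shift) auto
  have "(\<integral>\<^sup>+x. ennreal (norm (f (x + h))) \<partial>M) = (\<integral>\<^sup>+x. ennreal (norm (f x)) \<partial>M)"
    using assms(1) borel_measurable_integrable[OF assms(2)]
    by (intro nn_integral_shift) (auto simp: periodic_def)
  then show "(\<integral>\<^sup>+x. ennreal (norm (f (x + h))) \<partial>M) < \<infinity>"
    using assms(2) by (simp add: integrable_iff_bounded)
qed

lemma integral_shift_real:
  fixes f :: "real^'n \<Rightarrow> real"
  assumes "periodic f" "integrable M f"
  shows "(LINT x|M. f (x + h)) = (LINT x|M. f x)"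
proof -
  note [measurable] = borel_measurable_integrable[OF assms(2)]
  have "(\<integral>\<^sup>+x. ennreal (f (x + h)) \<partial>M) = (\<integral>\<^sup>+x. ennreal (f x) \<partial>M)"
    using assms(1) by (intro nn_integral_shift) (auto simp: periodic_def)
  moreover have "(\<integral>\<^sup>+x. ennreal (- f (x + h)) \<partial>M) = (\<integral>\<^sup>+x. ennreal (- f x) \<partial>M)"
    using assms(1) by (intro nn_integral_shift) (auto simp: periodic_def)
  ultimately show ?thesis
    using assms integrable_shift[OF assms, of h] by (simp add: real_lebesgue_integral_def)
qed

lemma integral_shift:
  fixes f :: "real^'n \<Rightarrow> complex"
  assumes "periodic f" "integrable M f"
  shows "(LINT x|M. f (x + h)) = (LINT x|M. f x)"
proof (rule complex_eqI)
  have p: "periodic (\<lambda>x. Re (f x))" "periodic (\<lambda>x. Im (f x))"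
    using assms(1) by (auto simp: periodic_def)
  show "Re (LINT x|M. f (x + h)) = Re (LINT x|M. f x)"
    using integral_shift_real[OF p(1) integrable_Re[OF assms(2)], of h] integrable_shift[OF assms, of h] assms(2)
    by (simp add: integral_Re)
  show "Im (LINT x|M. f (x + h)) = Im (LINT x|M. f x)"
    using integral_shift_real[OF p(2) integrable_Im[OF assms(2)], of h] integrable_shift[OF assms, of h] assms(2)
    by (simp add: integral_Im)
qed

section \<open>Square-integrable functions and their Fourier coefficients\<close>

definition sqint :: "(real^'n \<Rightarrow> complex) set" where
  "sqint = {f \<in> borel_measurable M. integrable M (\<lambda>x. (cmod (f x))\<^sup>2)}"

lemma sqintD:
  assumes "f \<in> sqint"
  shows "f \<in> borel_measurable M" "integrable M (\<lambda>x. (cmod (f x))\<^sup>2)"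
  using assms by (auto simp: sqint_def)

text \<open>Periodicity is split off because the density argument passes through indicators of
  subsets of \<Omega> and simple functions, which are not periodic. Only the shift formulas use
  periodicity.\<close>

lemma L2_space_iff: "f \<in> L2_space A \<Omega> \<longleftrightarrow> periodic f \<and> f \<in> sqint"
  by (auto simp: L2_space_def periodic_def sqint_def)

lemma sqint_bounded:
  assumes [measurable]: "f \<in> borel_measurable M" and "\<And>x. cmod (f x) \<le> B"
  shows "f \<in> sqint"
proof -
  have "(cmod (f x))\<^sup>2 \<le> B\<^sup>2" for x
    using assms(2)[of x] by (intro power_mono) auto
  then have "integrable M (\<lambda>x. (cmod (f x))\<^sup>2)"
    by (intro integrable_const_bound[of _ "B\<^sup>2"]) auto
  then show ?thesis by (simp add: sqint_def)
qed

lemma sqint_dominated: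
  assumes [measurable]: "f \<in> borel_measurable M" and g: "g \<in> sqint"
    and "\<And>x. x \<in> \<Omega> \<Longrightarrow> cmod (f x) \<le> c * cmod (g x)"
  shows "f \<in> sqint"
proof -
  have "integrable M (\<lambda>x. c\<^sup>2 * (cmod (g x))\<^sup>2)"
    using sqintD[OF g] by simp
  then have "integrable M (\<lambda>x. (cmod (f x))\<^sup>2)"
  proof (rule Bochner_Integration.integrable_bound)
    show "AE x in M. norm ((cmod (f x))\<^sup>2) \<le> norm (c\<^sup>2 * (cmod (g x))\<^sup>2)"
    proof (rule AE_I2)
      fix x assume "x \<in> space M"
      then have "cmod (f x) \<le> c * cmod (g x)" using assms(3) by simp
      then have "(cmod (f x))\<^sup>2 \<le> (c * cmod (g x))\<^sup>2" by (intro power_mono) auto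
      then show "norm ((cmod (f x))\<^sup>2) \<le> norm (c\<^sup>2 * (cmod (g x))\<^sup>2)"
        by (simp add: power_mult_distrib)
    qed
  qed auto
  then show ?thesis by (simp add: sqint_def)
qed

lemma norm_add_sq_le:
  fixes a b :: "'b::real_normed_vector"
  shows "(norm (a + b))\<^sup>2 \<le> 2 * (norm a)\<^sup>2 + 2 * (norm b)\<^sup>2"
proof -
  have "(norm (a + b))\<^sup>2 \<le> (norm a + norm b)\<^sup>2"
    by (intro power_mono norm_triangle_ineq) auto
  also have "\<dots> \<le> 2 * (norm a)\<^sup>2 + 2 * (norm b)\<^sup>2"
    using sum_squares_bound[of "norm a" "norm b"] by (simp add: power2_sum)
  finally show ?thesis .
qed

lemma sqint_add:
  assumes "f \<in> sqint" "g \<in> sqint"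
  shows "(\<lambda>x. f x + g x) \<in> sqint"
proof -
  note [measurable] = sqintD(1)[OF assms(1)] sqintD(1)[OF assms(2)]
  have "integrable M (\<lambda>x. 2 * (cmod (f x))\<^sup>2 + 2 * (cmod (g x))\<^sup>2)"
    using sqintD(2)[OF assms(1)] sqintD(2)[OF assms(2)] by simp
  then have "integrable M (\<lambda>x. (cmod (f x + g x))\<^sup>2)"
    by (rule Bochner_Integration.integrable_bound) (auto simp: norm_add_sq_le)
  then show ?thesis by (simp add: sqint_def)
qed

lemma sqint_scale:
  assumes "f \<in> sqint"
  shows "(\<lambda>x. c * f x) \<in> sqint"
  using sqintD[OF assms] by (simp add: sqint_def norm_mult power_mult_distrib)

lemma sqint_diff:
  assumes "f \<in> sqint" "g \<in> sqint"
  shows "(\<lambda>x. f x - g x) \<in> sqint"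
  using sqint_add[OF assms(1) sqint_scale[OF assms(2), of "-1"]] by simp

lemma sqint_continuous_bounded:
  assumes "continuous_on UNIV f" "\<And>x. cmod (f x) \<le> B"
  shows "f \<in> sqint"
  using assms by (intro sqint_bounded borel_measurable_lebesgue_on_continuous)

lemma sqint_chi: "chi \<kappa> \<in> sqint"
  by (intro sqint_continuous_bounded[of _ 1] continuous_on_chi) auto

lemma sqint_trig_poly: "p \<in> trig_poly A \<Longrightarrow> p \<in> sqint"
  by (induction rule: trig_poly.induct) (auto intro: sqint_chi sqint_add sqint_scale)

text \<open>The measure is finite and |f| is at most 1 + |f|^2 pointwise.\<close>

lemma integrable_mult_cnj_chi:
  assumes "f \<in> sqint"
  shows "integrable M (\<lambda>x. f x * cnj (chi \<kappa> x))"
proof -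
  note [measurable] = sqintD(1)[OF assms]
  have [measurable]: "(\<lambda>x. cnj (chi \<kappa> x)) \<in> borel_measurable M"
    unfolding cnj_chi by measurable
  have "integrable M (\<lambda>x. 1 + (cmod (f x))\<^sup>2)"
    using sqintD(2)[OF assms] by simp
  then show ?thesis
  proof (rule Bochner_Integration.integrable_bound)
    have "cmod (f x) \<le> 1 + (cmod (f x))\<^sup>2" for x
      using sum_squares_bound[of "cmod (f x)" 1] norm_ge_zero[of "f x"]
      unfolding power_one mult_1_right by linarith
    then show "AE x in M. cmod (f x * cnj (chi \<kappa> x)) \<le> norm (1 + (cmod (f x))\<^sup>2)"
      by (auto simp: norm_mult intro!: AE_I2)
  qed measurable
qed

lemma fc_eq: "fc f \<kappa> = (LINT x|M. f x * cnj (chi \<kappa> x)) / m"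
proof -
  have "exp (- 2 * complex_of_real pi * \<i> * complex_of_real (\<kappa> \<bullet> x)) = cnj (chi \<kappa> x)" for x
    by (simp add: chi_def cis_cnj exp_eq_polar Re_exp Im_exp complex_eq_iff mult_ac)
  then show ?thesis
    unfolding fourier_coeff_def by simp
qed

lemma fc_add:
  assumes "f \<in> sqint" "g \<in> sqint"
  shows "fc (\<lambda>x. f x + g x) \<kappa> = fc f \<kappa> + fc g \<kappa>"
  using integrable_mult_cnj_chi[OF assms(1), of \<kappa>] integrable_mult_cnj_chi[OF assms(2), of \<kappa>]
  by (simp add: fc_eq ring_distribs add_divide_distrib)

lemma fc_scale: "fc (\<lambda>x. c * f x) \<kappa> = c * fc f \<kappa>"
  by (simp add: fc_eq mult.assoc)

lemma fc_diff:
  assumes "f \<in> sqint" "g \<in> sqint"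
  shows "fc (\<lambda>x. f x - g x) \<kappa> = fc f \<kappa> - fc g \<kappa>"
  using fc_add[OF assms(1) sqint_scale[OF assms(2), of "-1"], of \<kappa>] fc_scale[of "-1" g \<kappa>] by simp

text \<open>The product of f with the conjugate character is periodic, so the shift can be undone
  under the integral at the price of the factor \<open>chi \<kappa> h\<close>.\<close>

lemma fc_shift:
  assumes "f \<in> L2_space A \<Omega>" "\<kappa> \<in> dual_lattice A"
  shows "fc (\<lambda>x. f (x + h)) \<kappa> = chi \<kappa> h * fc f \<kappa>"
proof -
  let ?g = "\<lambda>x. f x * cnj (chi \<kappa> x)"
  have f: "periodic f" "f \<in> sqint" using assms(1) by (auto simp: L2_space_iff)
  have g: "periodic ?g" using f(1) periodic_chi[OF assms(2)] by (simp add: periodic_def)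
  have "f (x + h) * cnj (chi \<kappa> x) = chi \<kappa> h * ?g (x + h)" for x
    by (simp add: chi_add_right mult_ac)
  then have "(LINT x|M. f (x + h) * cnj (chi \<kappa> x)) = (LINT x|M. chi \<kappa> h * ?g (x + h))"
    by (intro Bochner_Integration.integral_cong refl)
  also have "\<dots> = chi \<kappa> h * (LINT x|M. ?g (x + h))"
    by (rule integral_mult_right_zero)
  also have "(LINT x|M. ?g (x + h)) = (LINT x|M. ?g x)"
    by (rule integral_shift[OF g integrable_mult_cnj_chi[OF f(2)]])
  finally show ?thesis by (simp add: fc_eq)
qed

text \<open>For \<open>\<kappa> \<noteq> 0\<close> the integral of \<open>chi \<kappa>\<close> vanishes because a translation by half a period
  changes its sign.\<close>

lemma fc_chi:
  assumes "\<kappa> \<in> dual_lattice A" "\<mu> \<in> dual_lattice A"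
  shows "fc (chi \<kappa>) \<mu> = (if \<kappa> = \<mu> then 1 else 0)"
proof (cases "\<kappa> = \<mu>")
  case True
  then show ?thesis using m_pos by (simp add: fc_eq measure_space_M scaleR_conv_of_real)
next
  case False
  define \<nu> where "\<nu> = \<kappa> + - \<mu>"
  have \<nu>: "\<nu> \<in> dual_lattice A" "\<nu> \<noteq> 0"
    using False dual_lattice_add[OF assms(1) dual_lattice_uminus[OF assms(2)]] by (auto simp: \<nu>_def)
  define h where "h = (1 / (2 * (\<nu> \<bullet> \<nu>))) *\<^sub>R \<nu>"
  have "chi \<nu> h = -1"
    using \<nu> by (simp add: chi_def h_def)
  have "integrable M (chi \<nu>)"
    using integrable_mult_cnj_chi[OF sqint_chi, of \<nu> 0] by simp
  then have "(LINT x|M. chi \<nu> (x + h)) = (LINT x|M. chi \<nu> x)"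
    by (intro integral_shift periodic_chi \<nu>)
  then have "(LINT x|M. chi \<nu> x) = 0"
    using \<open>chi \<nu> h = -1\<close> by (simp add: chi_add_right)
  then show ?thesis
    using False by (simp add: fc_eq cnj_chi chi_add_left[symmetric] \<nu>_def)
qed

section \<open>The squared norm, orthogonal expansion and Bessel's inequality\<close>

definition nsq :: "(real^'n \<Rightarrow> complex) \<Rightarrow> real" where
  "nsq f = (LINT x|M. (cmod (f x))\<^sup>2) / m"

lemma nsq_nonneg: "0 \<le> nsq f"
  using m_pos by (simp add: nsq_def)

lemma L2_norm_eq: "L2_norm \<Omega> f = sqrt (nsq f)"
  by (simp add: L2_norm_def nsq_def)

text \<open>Stands in for the triangle inequality while all estimates stay with squared norms. The
  two factors 2 are the origin of the tolerances \<open>e / 4\<close> below.\<close>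

lemma nsq_add_le:
  assumes "f \<in> sqint" "g \<in> sqint"
  shows "nsq (\<lambda>x. f x + g x) \<le> 2 * nsq f + 2 * nsq g"
proof -
  have "(LINT x|M. (cmod (f x + g x))\<^sup>2) \<le> (LINT x|M. 2 * (cmod (f x))\<^sup>2 + 2 * (cmod (g x))\<^sup>2)"
    using sqintD(2)[OF sqint_add[OF assms]] sqintD(2)[OF assms(1)] sqintD(2)[OF assms(2)]
    by (intro integral_mono norm_add_sq_le) auto
  also have "\<dots> = 2 * (LINT x|M. (cmod (f x))\<^sup>2) + 2 * (LINT x|M. (cmod (g x))\<^sup>2)"
    using sqintD(2)[OF assms(1)] sqintD(2)[OF assms(2)] by simp
  finally show ?thesis
    using m_pos by (simp add: nsq_def field_simps)
qed

lemma nsq_scale: "nsq (\<lambda>x. c * f x) = (cmod c)\<^sup>2 * nsq f"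
  by (simp add: nsq_def norm_mult power_mult_distrib)

lemma nsq_le_bound:
  assumes "\<And>x. x \<in> \<Omega> \<Longrightarrow> cmod (f x) \<le> e" and [measurable]: "f \<in> borel_measurable M" and "0 \<le> e"
  shows "nsq f \<le> e\<^sup>2"
proof -
  have le: "(cmod (f x))\<^sup>2 \<le> e\<^sup>2" if "x \<in> \<Omega>" for x
    using assms that by (intro power_mono) auto
  have "(LINT x|M. (cmod (f x))\<^sup>2) \<le> (LINT x|M. e\<^sup>2)"
    using le by (intro integral_mono integrable_const_bound[of _ "e\<^sup>2"]) auto
  also have "\<dots> = m * e\<^sup>2" by (simp add: measure_space_M)
  finally show ?thesis using m_pos by (simp add: nsq_def field_simps)
qed

text \<open>Completing the square in \<open>c\<close> after expanding |f - c chi|^2; characters have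
  modulus 1.\<close>

lemma nsq_diff_chi:
  assumes "f \<in> sqint"
  shows "nsq (\<lambda>x. f x - c * chi \<kappa> x) = nsq f - (cmod (fc f \<kappa>))\<^sup>2 + (cmod (fc f \<kappa> - c))\<^sup>2"
proof -
  let ?g = "\<lambda>x. f x * cnj (chi \<kappa> x)"
  define R where "R x = Re (cnj c * ?g x)" for x
  have "(cmod (f x - c * chi \<kappa> x))\<^sup>2 = (cmod (f x))\<^sup>2 - 2 * R x + (cmod c)\<^sup>2" for x
  proof -
    have "(cmod (f x - c * chi \<kappa> x))\<^sup>2 = (cmod (f x))\<^sup>2 - 2 * Re (f x * cnj (c * chi \<kappa> x)) + (cmod (c * chi \<kappa> x))\<^sup>2"
      unfolding cmod_power2 by (simp add: power2_eq_square algebra_simps)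
    then show ?thesis by (simp add: R_def norm_mult mult_ac)
  qed
  moreover have g: "integrable M ?g" by (rule integrable_mult_cnj_chi[OF assms])
  moreover have "integrable M R"
    unfolding R_def using g by (intro integrable_Re integrable_mult_right)
  ultimately have "(LINT x|M. (cmod (f x - c * chi \<kappa> x))\<^sup>2) =
      (LINT x|M. (cmod (f x))\<^sup>2) - 2 * (LINT x|M. R x) + (LINT x|M. (cmod c)\<^sup>2)"
    using sqintD(2)[OF assms] by simp
  also have "(LINT x|M. R x) = (LINT x|M. Re (cnj c * ?g x))"
    by (simp add: R_def)
  also have "(LINT x|M. Re (cnj c * ?g x)) = Re (cnj c * (LINT x|M. ?g x))"
    using g by (subst integral_Re) auto
  also have "(LINT x|M. ?g x) = m * fc f \<kappa>"
    using m_pos by (simp add: fc_eq)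
  finally have "nsq (\<lambda>x. f x - c * chi \<kappa> x) = nsq f - 2 * Re (cnj c * fc f \<kappa>) + (cmod c)\<^sup>2"
    using m_pos by (simp add: nsq_def field_simps measure_space_M)
  then show ?thesis
    unfolding cmod_power2 by (simp add: power2_eq_square algebra_simps)
qed

text \<open>Characters are subtracted one at a time. The induction also carries that coefficients
  outside F are unchanged, which makes the one-character formula for the remainder speak about
  \<open>fc f\<close>. Choosing c as the coefficients of f gives Bessel; dropping the last sum gives
  the best-approximation bound used for Parseval.\<close>

lemma nsq_diff_sum_chi:
  assumes "f \<in> sqint" "finite F" "F \<subseteq> dual_lattice A"
  shows "nsq (\<lambda>x. f x - (\<Sum>\<kappa>\<in>F. c \<kappa> * chi \<kappa> x)) =
    nsq f - (\<Sum>\<kappa>\<in>F. (cmod (fc f \<kappa>))\<^sup>2) + (\<Sum>\<kappa>\<in>F. (cmod (fc f \<kappa> - c \<kappa>))\<^sup>2) \<and>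
    (\<lambda>x. f x - (\<Sum>\<kappa>\<in>F. c \<kappa> * chi \<kappa> x)) \<in> sqint \<and>
    (\<forall>\<mu>\<in>dual_lattice A - F. fc (\<lambda>x. f x - (\<Sum>\<kappa>\<in>F. c \<kappa> * chi \<kappa> x)) \<mu> = fc f \<mu>)"
  using assms(2,3)
proof (induction F rule: finite_induct)
  case empty
  then show ?case using assms(1) by simp
next
  case (insert \<nu> F)
  define g where "g x = f x - (\<Sum>\<kappa>\<in>F. c \<kappa> * chi \<kappa> x)" for x
  have eq: "f x - (\<Sum>\<kappa>\<in>insert \<nu> F. c \<kappa> * chi \<kappa> x) = g x - c \<nu> * chi \<nu> x" for x
    using insert by (simp add: g_def)
  have IH: "nsq g = nsq f - (\<Sum>\<kappa>\<in>F. (cmod (fc f \<kappa>))\<^sup>2) + (\<Sum>\<kappa>\<in>F. (cmod (fc f \<kappa> - c \<kappa>))\<^sup>2)"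
    "g \<in> sqint" "\<And>\<mu>. \<mu> \<in> dual_lattice A - F \<Longrightarrow> fc g \<mu> = fc f \<mu>"
    using insert unfolding g_def[abs_def] by auto
  have "fc (\<lambda>x. g x - c \<nu> * chi \<nu> x) \<mu> = fc f \<mu>" if "\<mu> \<in> dual_lattice A - insert \<nu> F" for \<mu>
    using that IH(3)[of \<mu>] insert.prems
    by (auto simp: fc_diff[OF IH(2) sqint_scale[OF sqint_chi]] fc_scale fc_chi)
  moreover have "(\<lambda>x. g x - c \<nu> * chi \<nu> x) \<in> sqint"
    by (intro sqint_diff sqint_scale sqint_chi IH)
  ultimately show ?case
    unfolding eq nsq_diff_chi[OF IH(2)] using IH insert by auto
qed

lemma bessel:
  assumes "f \<in> sqint" "finite F" "F \<subseteq> dual_lattice A"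
  shows "(\<Sum>\<kappa>\<in>F. (cmod (fc f \<kappa>))\<^sup>2) \<le> nsq f"
  using nsq_diff_sum_chi[OF assms, of "fc f"] nsq_nonneg[of "\<lambda>x. f x - (\<Sum>\<kappa>\<in>F. fc f \<kappa> * chi \<kappa> x)"]
  by simp

lemma nsq_tendsto_zero:
  assumes "\<And>i. s i \<in> borel_measurable M" "w \<in> sqint"
    and lim: "\<And>x. x \<in> \<Omega> \<Longrightarrow> (\<lambda>i. s i x) \<longlonglongrightarrow> 0"
    and bound: "\<And>i x. x \<in> \<Omega> \<Longrightarrow> cmod (s i x) \<le> cmod (w x)"
  shows "(\<lambda>i. nsq (s i)) \<longlonglongrightarrow> 0"
proof -
  note [measurable] = assms(1)
  have "(\<lambda>i. LINT x|M. (cmod (s i x))\<^sup>2) \<longlonglongrightarrow> (LINT x|M. 0)"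
  proof (rule integral_dominated_convergence[OF _ _ sqintD(2)[OF assms(2)]])
    show "AE x in M. (\<lambda>i. (cmod (s i x))\<^sup>2) \<longlonglongrightarrow> 0"
      using tendsto_power[OF tendsto_norm[OF lim], of _ 2] by (intro AE_I2) simp
    show "AE x in M. norm ((cmod (s i x))\<^sup>2) \<le> (cmod (w x))\<^sup>2" for i
      using bound by (intro AE_I2) (auto intro!: power_mono)
  qed auto
  then show ?thesis
    unfolding nsq_def using tendsto_divide_zero by fastforce
qed

section \<open>Density of trigonometric polynomials in the square-integrable functions\<close>

definition trig_closure :: "(real^'n \<Rightarrow> complex) set" where
  "trig_closure = {f \<in> sqint. \<forall>e>0. \<exists>p\<in>trig_poly A. nsq (\<lambda>x. f x - p x) < e}"

lemma trig_closure_closed: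
  assumes f: "f \<in> sqint" and "\<And>e. 0 < e \<Longrightarrow> \<exists>g\<in>trig_closure. nsq (\<lambda>x. f x - g x) < e"
  shows "f \<in> trig_closure"
proof -
  have "\<exists>p\<in>trig_poly A. nsq (\<lambda>x. f x - p x) < e" if "0 < e" for e
  proof -
    obtain g where g: "g \<in> trig_closure" "nsq (\<lambda>x. f x - g x) < e / 4"
      using assms(2)[of "e / 4"] \<open>0 < e\<close> by auto
    then obtain p where p: "p \<in> trig_poly A" "nsq (\<lambda>x. g x - p x) < e / 4"
      using \<open>0 < e\<close> by (auto simp: trig_closure_def dest!: spec[of _ "e / 4"])
    have "nsq (\<lambda>x. (f x - g x) + (g x - p x)) \<le> 2 * nsq (\<lambda>x. f x - g x) + 2 * nsq (\<lambda>x. g x - p x)"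
      using g(1) p(1) f by (intro nsq_add_le sqint_diff) (auto simp: trig_closure_def sqint_trig_poly)
    then show ?thesis using p g by (intro bexI[of _ p]) auto
  qed
  then show ?thesis using f by (simp add: trig_closure_def)
qed

text \<open>Dominated convergence. Since the limit and the bound are asked for on \<Omega> only,
  constant sequences also transfer membership between functions that agree on \<Omega>.\<close>

lemma trig_closure_limit:
  assumes s: "\<And>i. s i \<in> trig_closure" and f: "f \<in> sqint" and w: "w \<in> sqint"
    and lim: "\<And>x. x \<in> \<Omega> \<Longrightarrow> (\<lambda>i. s i x) \<longlonglongrightarrow> f x"
    and bound: "\<And>i x. x \<in> \<Omega> \<Longrightarrow> cmod (f x - s i x) \<le> cmod (w x)"
  shows "f \<in> trig_closure"
proof (rule trig_closure_closed[OF f])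
  fix e :: real assume "0 < e"
  have s': "s i \<in> sqint" for i using s by (simp add: trig_closure_def)
  have "(\<lambda>i. nsq (\<lambda>x. f x - s i x)) \<longlonglongrightarrow> 0"
  proof (rule nsq_tendsto_zero[OF _ w])
    show "(\<lambda>i. f x - s i x) \<longlonglongrightarrow> 0" if "x \<in> \<Omega>" for x
      using tendsto_diff[OF tendsto_const lim[OF that], of "f x"] by simp
  qed (use bound sqintD(1)[OF sqint_diff[OF f s']] in auto)
  then have "\<forall>\<^sub>F i in sequentially. nsq (\<lambda>x. f x - s i x) < e"
    using \<open>0 < e\<close> by (rule order_tendstoD)
  then obtain i where "nsq (\<lambda>x. f x - s i x) < e"
    by (auto simp: eventually_sequentially)
  then show "\<exists>g\<in>trig_closure. nsq (\<lambda>x. f x - g x) < e" using s by blast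
qed

lemma trig_poly_in_closure: "p \<in> trig_poly A \<Longrightarrow> p \<in> trig_closure"
  unfolding trig_closure_def by (auto simp: sqint_trig_poly nsq_def intro!: bexI[of _ p])

lemma trig_closure_add:
  assumes "f \<in> trig_closure" "g \<in> trig_closure"
  shows "(\<lambda>x. f x + g x) \<in> trig_closure"
proof -
  have fg: "f \<in> sqint" "g \<in> sqint" using assms by (auto simp: trig_closure_def)
  have "\<exists>p\<in>trig_poly A. nsq (\<lambda>x. (f x + g x) - p x) < e" if "0 < e" for e
  proof -
    obtain p q where p: "p \<in> trig_poly A" "nsq (\<lambda>x. f x - p x) < e / 4"
      and q: "q \<in> trig_poly A" "nsq (\<lambda>x. g x - q x) < e / 4"
      using assms \<open>0 < e\<close> by (auto simp: trig_closure_def dest!: spec[of _ "e / 4"])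
    have "nsq (\<lambda>x. (f x - p x) + (g x - q x)) \<le> 2 * nsq (\<lambda>x. f x - p x) + 2 * nsq (\<lambda>x. g x - q x)"
      using fg p(1) q(1) by (intro nsq_add_le sqint_diff) (auto simp: sqint_trig_poly)
    then have "nsq (\<lambda>x. (f x + g x) - (p x + q x)) < e"
      using p q by (simp add: algebra_simps)
    then show ?thesis using trig_poly.add[OF p(1) q(1)] by (rule bexI)
  qed
  then show ?thesis using sqint_add[OF fg] by (simp add: trig_closure_def)
qed

lemma trig_closure_scale:
  assumes "f \<in> trig_closure"
  shows "(\<lambda>x. c * f x) \<in> trig_closure"
proof -
  have f: "f \<in> sqint" using assms by (auto simp: trig_closure_def)
  have "\<exists>p\<in>trig_poly A. nsq (\<lambda>x. c * f x - p x) < e" if "0 < e" for e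
  proof -
    \<comment> \<open>Dividing the tolerance by 1 + |c|^2 instead of |c|^2 includes the case c =
      0.\<close>
    have pos: "0 < 1 + (cmod c)\<^sup>2" by (simp add: add_pos_nonneg)
    then obtain p where p: "p \<in> trig_poly A" "nsq (\<lambda>x. f x - p x) < e / (1 + (cmod c)\<^sup>2)"
      using assms \<open>0 < e\<close> by (auto simp: trig_closure_def dest!: spec[of _ "e / (1 + (cmod c)\<^sup>2)"])
    have "nsq (\<lambda>x. c * f x - c * p x) = (cmod c)\<^sup>2 * nsq (\<lambda>x. f x - p x)"
      using nsq_scale[of c "\<lambda>x. f x - p x"] by (simp add: algebra_simps)
    also have "\<dots> \<le> (1 + (cmod c)\<^sup>2) * nsq (\<lambda>x. f x - p x)"
      using nsq_nonneg by (intro mult_right_mono) auto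
    also have "\<dots> < e" using p(2) pos by (simp add: field_simps)
    finally show ?thesis using trig_poly.scale[OF p(1), of c] by (rule bexI)
  qed
  then show ?thesis using sqint_scale[OF f] by (simp add: trig_closure_def)
qed

lemma trig_closure_sum:
  assumes "finite I" "\<And>i. i \<in> I \<Longrightarrow> s i \<in> trig_closure"
  shows "(\<lambda>x. \<Sum>i\<in>I. s i x) \<in> trig_closure"
  using assms
proof (induction I rule: finite_induct)
  case empty
  then show ?case using trig_poly_in_closure[OF trig_poly_const[of 0]] by simp
next
  case (insert i I)
  then have "(\<lambda>x. s i x + (\<Sum>i\<in>I. s i x)) \<in> trig_closure"
    by (intro trig_closure_add) auto
  then show ?case using insert by simp
qed

lemma trig_closure_continuous:
  fixes \<phi> :: "real^'n \<Rightarrow> real"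
  assumes "continuous_on UNIV \<phi>" "periodic \<phi>" "\<And>x. \<bar>\<phi> x\<bar> \<le> B"
  shows "(\<lambda>x. complex_of_real (\<phi> x)) \<in> trig_closure"
proof -
  have c: "continuous_on UNIV (\<lambda>x. complex_of_real (\<phi> x))"
    using assms(1) by (intro continuous_intros)
  have "\<exists>p\<in>trig_poly A. nsq (\<lambda>x. complex_of_real (\<phi> x) - p x) < e" if "0 < e" for e
  proof -
    \<comment> \<open>A uniform error below d gives only the weak bound d^2, so d^2 = e / 2 is taken
      strictly below e.\<close>
    define d where "d = sqrt (e / 2)"
    have d: "0 < d" "d\<^sup>2 < e" using \<open>0 < e\<close> by (auto simp: d_def)
    obtain p where p: "p \<in> trig_poly A" "\<And>x. cmod (complex_of_real (\<phi> x) - p x) < d"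
      using trig_poly_uniform_approx[OF inv assms(1) periodicD[OF assms(2)] d(1)] by blast
    have "nsq (\<lambda>x. complex_of_real (\<phi> x) - p x) \<le> d\<^sup>2"
      using p d c continuous_on_trig_poly[OF p(1)]
      by (intro nsq_le_bound borel_measurable_lebesgue_on_continuous continuous_on_diff)
        (auto intro: less_imp_le)
    then show ?thesis using p d by force
  qed
  then show ?thesis
    using sqint_continuous_bounded[OF c, of B] assms(3) by (simp add: trig_closure_def)
qed

text \<open>The periodic set C = K + L is closed as the sum of a compact and a closed set, and it
  meets \<Omega> only in K because representatives in \<Omega> are unique. Hence the continuous
  periodic cut-offs \<open>max 0 (1 - i * infdist x C)\<close> tend to the indicator of K on
  \<Omega>.\<close>

lemma trig_closure_indicator_compact:
  assumes K: "compact K" "K \<subseteq> \<Omega>"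
  shows "(\<lambda>x. complex_of_real (indicator K x)) \<in> trig_closure"
proof (cases "K = {}")
  case True
  then show ?thesis using trig_poly_in_closure[OF trig_poly_const[of 0]] by simp
next
  case False
  define C where "C = (\<Union>x\<in>K. \<Union>l\<in>lattice A. {x + l})"
  have "closed C"
    unfolding C_def by (intro compact_closed_sums K closed_lattice inv)
  have "C \<noteq> {}" using False lattice_zero unfolding C_def by blast
  have C_\<Omega>: "x \<in> C \<longleftrightarrow> x \<in> K" if "x \<in> \<Omega>" for x
  proof
    assume "x \<in> C"
    then obtain y l where y: "y \<in> K" "l \<in> lattice A" "x = y + l" by (auto simp: C_def)
    then have "l = 0"
      using that K(2) by (intro fundamental_domain_unique[OF fd, of y l 0]) (auto simp: lattice_zero)
    then show "x \<in> K" using y by simp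
  next
    assume "x \<in> K" then show "x \<in> C" unfolding C_def using lattice_zero by force
  qed
  have C_shift: "x + l \<in> C" if "x \<in> C" "l \<in> lattice A" for x l
    using that lattice_add unfolding C_def by (fastforce simp: add.assoc)
  have infdist_le: "infdist (x + l) C \<le> infdist x C" if "l \<in> lattice A" for x l
  proof -
    have "infdist (x + l) C \<le> dist x c" if "c \<in> C" for c
      using infdist_le[OF C_shift[OF \<open>c \<in> C\<close> \<open>l \<in> lattice A\<close>], of "x + l"] by simp
    then show ?thesis using \<open>C \<noteq> {}\<close> infdist_notempty[of C x] by (simp add: cINF_greatest)
  qed
  \<comment> \<open>The inequality for l at x and for - l at x + l gives equality.\<close>
  have per: "infdist (x + l) C = infdist x C" if "l \<in> lattice A" for x l
    using infdist_le[OF that, of x] infdist_le[OF lattice_uminus[OF that], of "x + l"] by simp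
  define \<phi> where "\<phi> i x = max 0 (1 - real i * infdist x C)" for i x
  have bounds: "0 \<le> \<phi> i x" "\<phi> i x \<le> 1" for i x
    using infdist_nonneg[of x C] by (auto simp: \<phi>_def)
  have \<phi>: "(\<lambda>x. complex_of_real (\<phi> i x)) \<in> trig_closure" for i
  proof (rule trig_closure_continuous[of _ 1])
    show "continuous_on UNIV (\<phi> i)" unfolding \<phi>_def by (intro continuous_intros)
    show "periodic (\<phi> i)" by (simp add: periodic_def \<phi>_def per)
    show "\<bar>\<phi> i x\<bar> \<le> 1" for x using bounds[of i x] by simp
  qed
  have Km[measurable]: "K \<in> sets M"
    using K fmeasurableD[OF lmeasurable_compact[OF K(1)]] by (auto simp: sets_restrict_space_iff)
  have ind: "(\<lambda>x. complex_of_real (indicator K x)) \<in> sqint"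
    by (intro sqint_bounded[of _ 1]) (auto simp: indicator_def)
  have one: "(\<lambda>x. 1) \<in> sqint" by (intro sqint_bounded[of _ 1]) auto
  show ?thesis
  proof (rule trig_closure_limit[OF \<phi> ind one])
    fix x assume x: "x \<in> \<Omega>"
    have "(\<lambda>i. \<phi> i x) \<longlonglongrightarrow> indicator K x"
    proof (cases "x \<in> K")
      case True
      then have "\<phi> i x = 1" for i using C_\<Omega>[OF x] by (simp add: \<phi>_def)
      then show ?thesis using True by simp
    next
      case False
      then have pos: "0 < infdist x C"
        using C_\<Omega>[OF x] \<open>closed C\<close> \<open>C \<noteq> {}\<close> infdist_pos_not_in_closed by blast
      obtain N where N: "1 / infdist x C < real N" using reals_Archimedean2 by blast
      have "\<phi> i x = 0" if "N \<le> i" for i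
      proof -
        have "1 \<le> real N * infdist x C" using N pos by (simp add: field_simps)
        also have "\<dots> \<le> real i * infdist x C" using that pos by (intro mult_right_mono) auto
        finally show ?thesis by (simp add: \<phi>_def)
      qed
      then have "\<forall>\<^sub>F i in sequentially. \<phi> i x = 0" by (auto simp: eventually_sequentially)
      then show ?thesis using False tendsto_eventually by fastforce
    qed
    then show "(\<lambda>i. complex_of_real (\<phi> i x)) \<longlonglongrightarrow> complex_of_real (indicator K x)"
      by (rule tendsto_of_real)
    fix i
    show "cmod (complex_of_real (indicator K x) - complex_of_real (\<phi> i x)) \<le> cmod 1"
      unfolding of_real_diff[symmetric] norm_of_real using bounds[of i x] by (auto simp: indicator_def)
  qed
qed

text \<open>Two approximations are nested: B by a closed subset T up to small measure, and T, which
  may be unbounded together with \<Omega>, by its compact intersections with growing balls.\<close>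

lemma trig_closure_indicator:
  assumes B: "B \<in> sets lebesgue" "B \<subseteq> \<Omega>"
  shows "(\<lambda>x. complex_of_real (indicator B x)) \<in> trig_closure"
proof (rule trig_closure_closed)
  have sets_M: "C \<in> sets M" if "C \<in> sets lebesgue" "C \<subseteq> \<Omega>" for C
    using that by (auto simp: sets_restrict_space_iff)
  have one: "(\<lambda>x. 1) \<in> sqint" by (intro sqint_bounded[of _ 1]) auto
  have ind: "(\<lambda>x. complex_of_real (indicator C x)) \<in> sqint" if "C \<in> sets lebesgue" "C \<subseteq> \<Omega>" for C
    using sets_M[OF that] by (intro sqint_bounded[of _ 1]) (auto simp: indicator_def)
  show "(\<lambda>x. complex_of_real (indicator B x)) \<in> sqint" by (rule ind[OF B])
  fix e :: real assume "0 < e"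
  \<comment> \<open>The factor m compensates the division by m in \<open>nsq\<close>.\<close>
  obtain T where T: "closed T" "T \<subseteq> B" "B - T \<in> lmeasurable" "emeasure lebesgue (B - T) < ennreal (e * m)"
    using sets_lebesgue_inner_closed[OF B(1), of "e * m"] \<open>0 < e\<close> m_pos by auto
  have Ts: "T \<in> sets lebesgue" using T(1) by simp
  show "\<exists>g\<in>trig_closure. nsq (\<lambda>x. complex_of_real (indicator B x) - g x) < e"
  proof (intro bexI)
    have "(cmod (complex_of_real (indicator B x) - complex_of_real (indicator T x)))\<^sup>2 = indicator (B - T) x" for x
      using T(2) by (auto simp: indicator_def)
    then have "nsq (\<lambda>x. complex_of_real (indicator B x) - complex_of_real (indicator T x)) = measure M (B - T) / m"
      using sets_M[of "B - T"] B Ts by (simp add: nsq_def Int_absorb2 subset_iff)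
    also have "measure M (B - T) = measure lebesgue (B - T)"
      using B by (intro measure_restrict_space) auto
    also have "\<dots> < e * m"
      using T(3,4) \<open>0 < e\<close> m_pos by (subst (asm) emeasure_eq_measure2) (auto simp: ennreal_less_iff)
    finally show "nsq (\<lambda>x. complex_of_real (indicator B x) - complex_of_real (indicator T x)) < e"
      using m_pos by (simp add: field_simps)
    show "(\<lambda>x. complex_of_real (indicator T x)) \<in> trig_closure"
    proof (rule trig_closure_limit[OF trig_closure_indicator_compact ind one])
      show "compact (T \<inter> cball 0 (real i))" for i
        using T(1) by (simp add: closed_Int_compact)
      fix x assume "x \<in> \<Omega>"
      obtain N where N: "norm x < real N" using reals_Archimedean2 by blast
      have "\<forall>\<^sub>F i in sequentially. complex_of_real (indicator (T \<inter> cball 0 (real i)) x) = complex_of_real (indicator T x)"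
        using eventually_ge_at_top[of N] by eventually_elim (use N in \<open>auto simp: indicator_def\<close>)
      then show "(\<lambda>i. complex_of_real (indicator (T \<inter> cball 0 (real i)) x)) \<longlonglongrightarrow> complex_of_real (indicator T x)"
        by (rule tendsto_eventually)
      show "cmod (complex_of_real (indicator T x) - complex_of_real (indicator (T \<inter> cball 0 (real i)) x)) \<le> cmod 1" for i
        by (auto simp: indicator_def)
    qed (use Ts T(2) B(2) in auto)
  qed
qed

text \<open>Simple functions dominated by 2 |f| converge to f pointwise on \<Omega>, and each of
  them is there a finite combination of indicators.\<close>

lemma sqint_in_trig_closure:
  assumes f: "f \<in> sqint"
  shows "f \<in> trig_closure"
proof -
  obtain s where s: "\<And>i. simple_function M (s i)" "\<And>x. x \<in> space M \<Longrightarrow> (\<lambda>i. s i x) \<longlonglongrightarrow> f x"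
    "\<And>i x. x \<in> space M \<Longrightarrow> dist (s i x) 0 \<le> 2 * dist (f x) 0"
    using borel_measurable_implies_sequence_metric[OF sqintD(1)[OF f], of 0] by metis
  have bm: "s i \<in> borel_measurable M" for i by (rule borel_measurable_simple_function[OF s(1)])
  have "s i \<in> trig_closure" for i
  proof -
    let ?g = "\<lambda>x. \<Sum>y\<in>s i ` space M. y * complex_of_real (indicator (s i -` {y} \<inter> space M) x)"
    have g: "?g \<in> trig_closure"
    proof (intro trig_closure_sum trig_closure_scale trig_closure_indicator)
      show "finite (s i ` space M)" using s(1) by (rule simple_functionD)
      fix y
      have "s i -` {y} \<inter> space M \<in> sets M" using s(1) by (rule simple_functionD)
      then show "s i -` {y} \<inter> space M \<in> sets lebesgue" "s i -` {y} \<inter> space M \<subseteq> \<Omega>"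
        by (auto simp: sets_restrict_space_iff)
    qed
    have eq: "?g x = s i x" if "x \<in> \<Omega>" for x
    proof -
      have "?g x = (\<Sum>y\<in>s i ` space M. if y = s i x then y else 0)"
        using that by (intro sum.cong) (auto simp: indicator_def)
      also have "\<dots> = s i x"
        using that simple_functionD(1)[OF s(1), of i] by (simp add: sum.delta')
      finally show ?thesis .
    qed
    have "s i \<in> sqint"
      using s(3)[of _ i] by (intro sqint_dominated[OF bm f, of _ 2]) auto
    \<comment> \<open>The combination of indicators equals \<open>s i\<close> on \<Omega> only; the
      limit lemma with a constant sequence bridges the difference elsewhere.\<close>
    then show ?thesis
    proof (rule trig_closure_limit[where s = "\<lambda>_. ?g", OF g _ f])
      show "(\<lambda>j. ?g x) \<longlonglongrightarrow> s i x" if "x \<in> \<Omega>" for x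
        by (simp only: eq[OF that] tendsto_const)
      show "cmod (s i x - ?g x) \<le> cmod (f x)" if "x \<in> \<Omega>" for x
        by (simp only: eq[OF that]) simp
    qed
  qed
  \<comment> \<open>The majorant is 3 |f| because |f - s_i| is at most |f| + 2 |f|.\<close>
  then show ?thesis
  proof (rule trig_closure_limit[OF _ f sqint_scale[OF f, of 3]])
    show "(\<lambda>i. s i x) \<longlonglongrightarrow> f x" if "x \<in> \<Omega>" for x
      using s(2) that by simp
    show "cmod (f x - s i x) \<le> cmod (3 * f x)" if "x \<in> \<Omega>" for i x
      using s(3)[of x i] that norm_triangle_ineq4[of "f x" "s i x"] by (simp add: norm_mult)
  qed
qed

text \<open>Bessel bounds the sum from above. Conversely, if p with frequencies F approximates f up
  to e, then the orthogonal projection onto F does at least as well, so the coefficients over F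
  alone reach \<open>nsq f - e\<close>.\<close>

theorem parseval:
  assumes f: "f \<in> sqint"
  shows "((\<lambda>\<kappa>. (cmod (fc f \<kappa>))\<^sup>2) has_sum nsq f) (dual_lattice A)"
proof -
  let ?a = "\<lambda>\<kappa>. (cmod (fc f \<kappa>))\<^sup>2"
  have "?a summable_on dual_lattice A"
    by (rule nonneg_bdd_above_summable_on)
      (auto intro!: bdd_aboveI[of _ "nsq f"] bessel[OF f])
  moreover have "infsum ?a (dual_lattice A) \<le> nsq f"
    using calculation by (intro infsum_le_finite_sums bessel[OF f])
  moreover have "nsq f \<le> infsum ?a (dual_lattice A) + e" if "0 < e" for e
  proof -
    obtain p where p: "p \<in> trig_poly A" "nsq (\<lambda>x. f x - p x) < e"
      using sqint_in_trig_closure[OF f] \<open>0 < e\<close> by (auto simp: trig_closure_def)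
    obtain F c where F: "finite F" "F \<subseteq> dual_lattice A" "p = (\<lambda>x. \<Sum>\<kappa>\<in>F. c \<kappa> * chi \<kappa> x)"
      using trig_poly_expansion[OF p(1)] by blast
    have "nsq f - (\<Sum>\<kappa>\<in>F. ?a \<kappa>) \<le> nsq (\<lambda>x. f x - p x)"
      using nsq_diff_sum_chi[OF f F(1,2), of c] by (simp add: F(3) sum_nonneg)
    moreover have "(\<Sum>\<kappa>\<in>F. ?a \<kappa>) \<le> infsum ?a (dual_lattice A)"
      using F calculation \<open>?a summable_on dual_lattice A\<close> by (intro finite_sum_le_infsum) auto
    ultimately show ?thesis using p by simp
  qed
  then have "nsq f \<le> infsum ?a (dual_lattice A)" by (rule field_le_epsilon)
  ultimately show ?thesis by (metis antisym has_sum_infsum)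
qed

end

subsection \<open>Increments and Fourier tails\<close>

lemma powr_double: "x powr (2 * b) = (x powr b)\<^sup>2" for x b :: real
  by (simp add: power2_eq_square powr_add[symmetric])

section \<open>Dyadic estimates between increments and tails, over finite frequency sets\<close>

lemma norm_chi_minus_one_sq: "(cmod (chi \<kappa> h - 1))\<^sup>2 = 2 - 2 * cos (2 * pi * (\<kappa> \<bullet> h))"
proof -
  have "(cmod (chi \<kappa> h - 1))\<^sup>2 = (cos (2 * pi * (\<kappa> \<bullet> h)))\<^sup>2 + (sin (2 * pi * (\<kappa> \<bullet> h)))\<^sup>2 - 2 * cos (2 * pi * (\<kappa> \<bullet> h)) + 1"
    by (simp add: chi_def cmod_power2 power2_diff)
  then show ?thesis by simp
qed

lemma norm_chi_minus_one_sq_le_4: "(cmod (chi \<kappa> h - 1))\<^sup>2 \<le> 4"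
  unfolding norm_chi_minus_one_sq using cos_ge_minus_one[of "2 * pi * (\<kappa> \<bullet> h)"] by linarith

text \<open>The left side is 4 sin(t)^2 with t = pi (\<kappa> \<bullet> h); then |sin t| \<le> |t|
  and Cauchy-Schwarz.\<close>

lemma norm_chi_minus_one_sq_le: "(cmod (chi \<kappa> h - 1))\<^sup>2 \<le> 4 * pi\<^sup>2 * (norm h)\<^sup>2 * (norm \<kappa>)\<^sup>2"
proof -
  define t where "t = pi * (\<kappa> \<bullet> h)"
  have "(cmod (chi \<kappa> h - 1))\<^sup>2 = 4 * (sin t)\<^sup>2"
    using cos_double_sin[of t] by (simp add: norm_chi_minus_one_sq t_def mult.assoc)
  also have "(sin t)\<^sup>2 \<le> t\<^sup>2"
    by (metis abs_le_square_iff abs_sin_x_le_abs_x)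
  also have "(\<kappa> \<bullet> h)\<^sup>2 \<le> (norm \<kappa> * norm h)\<^sup>2"
    using Cauchy_Schwarz_ineq2[of \<kappa> h] abs_le_square_iff by fastforce
  then have "t\<^sup>2 \<le> pi\<^sup>2 * (norm \<kappa> * norm h)\<^sup>2"
    by (simp add: t_def power_mult_distrib mult_left_mono)
  finally show ?thesis by (simp add: power_mult_distrib mult_ac)
qed

text \<open>The phase has absolute value between pi / 2 and pi, where the cosine is at most 0. This
  window is the one that a frequency band of ratio 2 can fill.\<close>

lemma norm_chi_minus_one_sq_ge_2:
  assumes "1 / 4 \<le> \<bar>\<kappa> \<bullet> h\<bar>" "\<bar>\<kappa> \<bullet> h\<bar> \<le> 1 / 2"
  shows "2 \<le> (cmod (chi \<kappa> h - 1))\<^sup>2"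
proof -
  have "cos (2 * pi * (\<kappa> \<bullet> h)) = cos \<bar>2 * pi * (\<kappa> \<bullet> h)\<bar>"
    by simp
  also have "\<dots> = cos (2 * pi * \<bar>\<kappa> \<bullet> h\<bar>)"
    by (simp only: abs_mult) simp
  also have "\<dots> \<le> cos (pi / 2)"
    using assms by (intro cos_monotone_0_pi_le) (auto simp: field_simps)
  finally show ?thesis by (simp add: norm_chi_minus_one_sq)
qed

lemma norm_axis_eq: "norm (axis j c :: real^'n) = \<bar>c\<bar>"
proof -
  have "axis j c = c *\<^sub>R (axis j 1 :: real^'n)" by (simp add: axis_def vec_eq_iff)
  then show ?thesis by (simp add: norm_axis_1)
qed

lemma sum_filter_split:
  fixes a :: "'a \<Rightarrow> real"
  assumes "finite F"
  shows "sum a F = sum a {x\<in>F. P x} + sum a {x\<in>F. \<not> P x}"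
  using sum.Int_Diff[OF assms, of a "{x. P x}"] by (simp add: Int_def set_diff_eq)

text \<open>Testing the increment with \<open>h\<close> along the \<open>j\<close>-th axis and of length \<open>1 / (4 r)\<close> controls
  the band \<open>r \<le> \<bar>\<kappa>\<^sub>j\<bar> < 2 r\<close>; the tail is a geometric sum of such bands.\<close>

lemma coordinate_tail_bound:
  fixes a :: "real^'n \<Rightarrow> real"
  assumes a: "\<And>\<kappa>. 0 \<le> a \<kappa>" and "0 < \<alpha>" "0 \<le> C" and F: "finite F"
    and inc: "\<And>h G. h \<noteq> 0 \<Longrightarrow> G \<subseteq> F \<Longrightarrow> (\<Sum>\<kappa>\<in>G. (cmod (chi \<kappa> h - 1))\<^sup>2 * a \<kappa>) \<le> C * norm h powr (2 * \<alpha>)"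
    and "0 < r"
  shows "(\<Sum>\<kappa>\<in>{\<kappa>\<in>F. r \<le> \<bar>\<kappa> $ j\<bar>}. a \<kappa>) \<le> C / (1 - 2 powr (- 2 * \<alpha>)) * r powr (- 2 * \<alpha>)"
proof -
  define q where "q = (2::real) powr (- 2 * \<alpha>)"
  have q: "0 < q" "q < 1"
    unfolding q_def using \<open>0 < \<alpha>\<close> powr_less_mono[of "- 2 * \<alpha>" 0 "2::real"] by auto
  have band: "(\<Sum>\<kappa>\<in>{\<kappa>\<in>F. r \<le> \<bar>\<kappa> $ j\<bar> \<and> \<bar>\<kappa> $ j\<bar> < 2 * r}. a \<kappa>) \<le> C * r powr (- 2 * \<alpha>)" if "0 < r" for r
  proof -
    let ?G = "{\<kappa>\<in>F. r \<le> \<bar>\<kappa> $ j\<bar> \<and> \<bar>\<kappa> $ j\<bar> < 2 * r}"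
    define h :: "real^'n" where "h = axis j (1 / (4 * r))"
    have h: "h \<noteq> 0" "norm h = 1 / (4 * r)" "\<kappa> \<bullet> h = \<kappa> $ j / (4 * r)" for \<kappa>
      using \<open>0 < r\<close> norm_axis_eq[of j "1 / (4 * r)"] by (auto simp: h_def inner_axis axis_eq_0_iff)
    have "a \<kappa> \<le> (cmod (chi \<kappa> h - 1))\<^sup>2 * a \<kappa>" if "\<kappa> \<in> ?G" for \<kappa>
    proof -
      have "2 \<le> (cmod (chi \<kappa> h - 1))\<^sup>2"
        using that \<open>0 < r\<close> by (intro norm_chi_minus_one_sq_ge_2) (auto simp: h field_simps)
      then have "1 * a \<kappa> \<le> (cmod (chi \<kappa> h - 1))\<^sup>2 * a \<kappa>"
        by (intro mult_right_mono a) auto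
      then show ?thesis by simp
    qed
    then have "(\<Sum>\<kappa>\<in>?G. a \<kappa>) \<le> (\<Sum>\<kappa>\<in>?G. (cmod (chi \<kappa> h - 1))\<^sup>2 * a \<kappa>)"
      by (rule sum_mono)
    also have "\<dots> \<le> C * norm h powr (2 * \<alpha>)"
      by (intro inc h) auto
    \<comment> \<open>The factor 1 / 4 in the length of h is given away to keep the constant
      simple.\<close>
    also have "norm h powr (2 * \<alpha>) \<le> (1 / r) powr (2 * \<alpha>)"
      using \<open>0 < r\<close> \<open>0 < \<alpha>\<close> unfolding h by (intro powr_mono2) (auto simp: field_simps)
    also have "\<dots> = r powr (- 2 * \<alpha>)"
      using \<open>0 < r\<close> by (simp add: powr_divide powr_minus_divide)
    finally show ?thesis using \<open>0 \<le> C\<close> by (simp add: mult_left_mono)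
  qed
  \<comment> \<open>The fixed point of K = C + K q: one band contributes C, and doubling r scales
    the rest by q < 1.\<close>
  define K where "K = C / (1 - q)"
  have K: "0 \<le> K" "C + K * q = K" using q \<open>0 \<le> C\<close> by (auto simp: K_def field_simps)
  \<comment> \<open>A finite F has no frequency beyond 2^k r for some k, so the recursion r -> 2 r
    starts from an empty tail.\<close>
  have step: "(\<Sum>\<kappa>\<in>{\<kappa>\<in>F. r \<le> \<bar>\<kappa> $ j\<bar>}. a \<kappa>) \<le> K * r powr (- 2 * \<alpha>)"
    if "0 < r" "\<forall>\<kappa>\<in>F. \<bar>\<kappa> $ j\<bar> < 2 ^ k * r" for r k
    using that
  proof (induction k arbitrary: r)
    case 0
    then have "{\<kappa>\<in>F. r \<le> \<bar>\<kappa> $ j\<bar>} = {}" by force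
    then have "(\<Sum>\<kappa>\<in>{\<kappa>\<in>F. r \<le> \<bar>\<kappa> $ j\<bar>}. a \<kappa>) = 0" by (simp only: sum.empty)
    then show ?case using K by simp
  next
    case (Suc k)
    have "{\<kappa>\<in>{\<kappa>\<in>F. r \<le> \<bar>\<kappa> $ j\<bar>}. \<bar>\<kappa> $ j\<bar> < 2 * r} = {\<kappa>\<in>F. r \<le> \<bar>\<kappa> $ j\<bar> \<and> \<bar>\<kappa> $ j\<bar> < 2 * r}"
      "{\<kappa>\<in>{\<kappa>\<in>F. r \<le> \<bar>\<kappa> $ j\<bar>}. \<not> \<bar>\<kappa> $ j\<bar> < 2 * r} = {\<kappa>\<in>F. 2 * r \<le> \<bar>\<kappa> $ j\<bar>}"
      using Suc.prems(1) by auto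
    then have "(\<Sum>\<kappa>\<in>{\<kappa>\<in>F. r \<le> \<bar>\<kappa> $ j\<bar>}. a \<kappa>) =
        (\<Sum>\<kappa>\<in>{\<kappa>\<in>F. r \<le> \<bar>\<kappa> $ j\<bar> \<and> \<bar>\<kappa> $ j\<bar> < 2 * r}. a \<kappa>) + (\<Sum>\<kappa>\<in>{\<kappa>\<in>F. 2 * r \<le> \<bar>\<kappa> $ j\<bar>}. a \<kappa>)"
      using sum_filter_split[of "{\<kappa>\<in>F. r \<le> \<bar>\<kappa> $ j\<bar>}" a "\<lambda>\<kappa>. \<bar>\<kappa> $ j\<bar> < 2 * r"] F by simp
    also have "\<dots> \<le> C * r powr (- 2 * \<alpha>) + K * (2 * r) powr (- 2 * \<alpha>)"
      using Suc.prems by (intro add_mono band Suc.IH) (auto simp: mult_ac)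
    also have "(2 * r) powr (- 2 * \<alpha>) = q * r powr (- 2 * \<alpha>)"
      using Suc.prems(1) by (simp add: q_def powr_mult)
    also have "C * r powr (- 2 * \<alpha>) + K * (q * r powr (- 2 * \<alpha>)) = (C + K * q) * r powr (- 2 * \<alpha>)"
      by (simp add: algebra_simps)
    finally show ?case unfolding K(2) .
  qed
  have "\<exists>k. \<forall>\<kappa>\<in>F. \<bar>\<kappa> $ j\<bar> < 2 ^ k * r"
  proof -
    define B where "B = (\<Sum>\<kappa>\<in>F. \<bar>\<kappa> $ j\<bar>)"
    obtain k where "B / r < 2 ^ k" using real_arch_pow[of 2 "B / r"] by auto
    then have "B < 2 ^ k * r" using \<open>0 < r\<close> by (simp add: field_simps)
    moreover have "\<bar>\<kappa> $ j\<bar> \<le> B" if "\<kappa> \<in> F" for \<kappa>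
      unfolding B_def using that F by (intro member_le_sum) auto
    ultimately show ?thesis by (meson le_less_trans)
  qed
  then show ?thesis using step[OF \<open>0 < r\<close>] by (auto simp: K_def q_def)
qed

text \<open>The Euclidean norm is at most the sum of the coordinate moduli, so a frequency with norm
  at least r has some coordinate of modulus at least r / n. Summing the coordinate bounds over j
  produces the constants n and (1 / n) to the power - 2 \<alpha>.\<close>

lemma tail_bound:
  fixes a :: "real^'n \<Rightarrow> real"
  assumes a: "\<And>\<kappa>. 0 \<le> a \<kappa>" and "0 < \<alpha>" "0 \<le> C"
    and inc: "\<And>h F. h \<noteq> 0 \<Longrightarrow> finite F \<Longrightarrow> F \<subseteq> D \<Longrightarrow> (\<Sum>\<kappa>\<in>F. (cmod (chi \<kappa> h - 1))\<^sup>2 * a \<kappa>) \<le> C * norm h powr (2 * \<alpha>)"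
  obtains K where "0 \<le> K" "\<And>r F. 0 < r \<Longrightarrow> finite F \<Longrightarrow> F \<subseteq> D \<Longrightarrow> (\<And>\<kappa>. \<kappa> \<in> F \<Longrightarrow> r \<le> norm \<kappa>) \<Longrightarrow> sum a F \<le> K * r powr (- 2 * \<alpha>)"
proof
  let ?n = "real CARD('n)"
  have n: "0 < ?n" by simp
  define K1 where "K1 = C / (1 - 2 powr (- 2 * \<alpha>))"
  define K where "K = ?n * (K1 * (1 / ?n) powr (- 2 * \<alpha>))"
  have "(2::real) powr (- 2 * \<alpha>) < 1"
    using \<open>0 < \<alpha>\<close> powr_less_mono[of "- 2 * \<alpha>" 0 "2::real"] by auto
  then have "0 \<le> K1" using \<open>0 \<le> C\<close> by (simp add: K1_def)
  then show "0 \<le> K" by (simp add: K_def)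
  fix r F assume r: "0 < r" and F: "finite F" "F \<subseteq> D" and rF: "\<And>\<kappa>. \<kappa> \<in> F \<Longrightarrow> r \<le> norm \<kappa>"
  have "a \<kappa> \<le> (\<Sum>j\<in>UNIV. if r / ?n \<le> \<bar>\<kappa> $ j\<bar> then a \<kappa> else 0)" if \<kappa>: "\<kappa> \<in> F" for \<kappa>
  proof -
    have "\<exists>j. r / ?n \<le> \<bar>\<kappa> $ j\<bar>"
    proof (rule ccontr)
      assume "\<nexists>j. r / ?n \<le> \<bar>\<kappa> $ j\<bar>"
      then have "(\<Sum>j\<in>UNIV. \<bar>\<kappa> $ j\<bar>) < (\<Sum>j\<in>(UNIV::'n set). r / ?n)"
        by (intro sum_strict_mono) (auto simp: not_le)
      then show False using norm_le_l1_cart[of \<kappa>] rF[OF \<kappa>] by simp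
    qed
    then obtain j where "r / ?n \<le> \<bar>\<kappa> $ j\<bar>" ..
    then have "a \<kappa> = (if r / ?n \<le> \<bar>\<kappa> $ j\<bar> then a \<kappa> else 0)" by simp
    also have "\<dots> \<le> (\<Sum>j\<in>UNIV. if r / ?n \<le> \<bar>\<kappa> $ j\<bar> then a \<kappa> else 0)"
      using a by (intro member_le_sum) auto
    finally show ?thesis .
  qed
  then have "sum a F \<le> (\<Sum>\<kappa>\<in>F. \<Sum>j\<in>UNIV. if r / ?n \<le> \<bar>\<kappa> $ j\<bar> then a \<kappa> else 0)"
    by (rule sum_mono)
  also have "\<dots> = (\<Sum>j\<in>UNIV. \<Sum>\<kappa>\<in>{\<kappa>\<in>F. r / ?n \<le> \<bar>\<kappa> $ j\<bar>}. a \<kappa>)"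
    using F by (subst sum.swap) (simp add: sum.inter_filter)
  also have "\<dots> \<le> (\<Sum>j\<in>(UNIV::'n set). K1 * (r / ?n) powr (- 2 * \<alpha>))"
    unfolding K1_def using F r
    by (intro sum_mono coordinate_tail_bound a assms(2,3) inc) (auto intro: finite_subset)
  also have "\<dots> = K * r powr (- 2 * \<alpha>)"
    using r powr_mult[of r "1 / ?n" "- 2 * \<alpha>"] by (simp add: K_def)
  finally show "sum a F \<le> K * r powr (- 2 * \<alpha>)" .
qed

text \<open>Frequencies are split at about 1 / |h|. Below, |chi - 1|^2 is at most a multiple of
  |h|^2 |\<kappa>|^2, and the bands sum to a geometric series with ratio
  \<open>2 powr (2 - 2 * \<beta>)\<close> > 1, dominated by its last term; this is where \<beta> < 1
  acts. Above, |chi - 1|^2 \<le> 4 and the tail bound applies directly.\<close>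

lemma increment_bound:
  fixes a :: "real^'n \<Rightarrow> real"
  assumes a: "\<And>\<kappa>. 0 \<le> a \<kappa>" and "\<beta> < 1" "0 \<le> K" "0 \<le> S"
    and S: "\<And>F. finite F \<Longrightarrow> F \<subseteq> D \<Longrightarrow> sum a F \<le> S"
    and tail: "\<And>r F. 0 < r \<Longrightarrow> finite F \<Longrightarrow> F \<subseteq> D \<Longrightarrow> (\<And>\<kappa>. \<kappa> \<in> F \<Longrightarrow> r \<le> norm \<kappa>) \<Longrightarrow> sum a F \<le> K * r powr (- 2 * \<beta>)"
    and "0 < \<beta>"
  obtains C where "0 \<le> C" "\<And>h F. h \<noteq> 0 \<Longrightarrow> norm h \<le> 1 \<Longrightarrow> finite F \<Longrightarrow> F \<subseteq> D \<Longrightarrow>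
    (\<Sum>\<kappa>\<in>F. (cmod (chi \<kappa> h - 1))\<^sup>2 * a \<kappa>) \<le> C * norm h powr (2 * \<beta>)"
proof
  define s where "s = 2 - 2 * \<beta>"
  have "0 < s" using \<open>\<beta> < 1\<close> by (simp add: s_def)
  define q where "q = (2::real) powr s"
  have q: "1 < q" unfolding q_def using \<open>0 < s\<close> powr_less_mono[of 0 s "2::real"] by auto
  \<comment> \<open>S starts the induction at |\<kappa>| \<le> 1; the second entry gives B + 4 K
    \<le> B q, which closes its step. The 4 comes from |\<kappa>|^2 \<le> (2 * 2^k)^2 on a
    band.\<close>
  define B where "B = max S (4 * K / (q - 1))"
  have B: "0 \<le> B" "S \<le> B" "B + 4 * K \<le> B * q"
  proof -
    have "4 * K / (q - 1) \<le> B" by (simp add: B_def)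
    then show "B + 4 * K \<le> B * q" using q by (simp add: field_simps)
  qed (use \<open>0 \<le> S\<close> in \<open>auto simp: B_def\<close>)
  \<comment> \<open>The summands belong to low and high frequencies;
    \<open>2 powr (2 * \<beta>)\<close> comes from 1 / 2^k < 2 |h|.\<close>
  define C where "C = 4 * pi\<^sup>2 * B + 4 * (K * 2 powr (2 * \<beta>))"
  show "0 \<le> C" using B \<open>0 \<le> K\<close> by (simp add: C_def)
  fix h :: "real^'n" and F assume h: "h \<noteq> 0" "norm h \<le> 1" and F: "finite F" "F \<subseteq> D"
  have head: "(\<Sum>\<kappa>\<in>{\<kappa>\<in>F. norm \<kappa> \<le> 2 ^ k}. (norm \<kappa>)\<^sup>2 * a \<kappa>) \<le> B * (2 ^ k) powr s" for k
  proof (induction k)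
    case 0
    have "(\<Sum>\<kappa>\<in>{\<kappa>\<in>F. norm \<kappa> \<le> 1}. (norm \<kappa>)\<^sup>2 * a \<kappa>) \<le> (\<Sum>\<kappa>\<in>{\<kappa>\<in>F. norm \<kappa> \<le> 1}. 1 * a \<kappa>)"
      by (intro sum_mono mult_right_mono a power_le_one) auto
    also have "\<dots> \<le> S" using F by (simp, intro S) auto
    finally show ?case using B by simp
  next
    case (Suc k)
    let ?p = "(2::real) ^ k"
    let ?G = "{\<kappa>\<in>F. norm \<kappa> \<le> 2 * ?p}"
    have sets: "{\<kappa>\<in>?G. norm \<kappa> \<le> ?p} = {\<kappa>\<in>F. norm \<kappa> \<le> ?p}"
      "{\<kappa>\<in>?G. \<not> norm \<kappa> \<le> ?p} = {\<kappa>\<in>F. ?p < norm \<kappa> \<and> norm \<kappa> \<le> 2 * ?p}"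
      by (auto intro: order_trans[of _ ?p])
    have "(\<Sum>\<kappa>\<in>{\<kappa>\<in>F. ?p < norm \<kappa> \<and> norm \<kappa> \<le> 2 * ?p}. (norm \<kappa>)\<^sup>2 * a \<kappa>) \<le>
        (\<Sum>\<kappa>\<in>{\<kappa>\<in>F. ?p < norm \<kappa> \<and> norm \<kappa> \<le> 2 * ?p}. (2 * ?p)\<^sup>2 * a \<kappa>)"
      by (intro sum_mono mult_right_mono a power_mono) auto
    also have "\<dots> = (2 * ?p)\<^sup>2 * (\<Sum>\<kappa>\<in>{\<kappa>\<in>F. ?p < norm \<kappa> \<and> norm \<kappa> \<le> 2 * ?p}. a \<kappa>)"
      by (simp add: sum_distrib_left)
    also have "\<dots> \<le> (2 * ?p)\<^sup>2 * (K * ?p powr (- 2 * \<beta>))"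
      using F by (intro mult_left_mono tail) auto
    also have "\<dots> = 4 * K * ?p powr s"
    proof -
      have "?p\<^sup>2 = ?p powr 2" by (simp add: powr_numeral del: power_mult)
      then have "?p\<^sup>2 * ?p powr (- 2 * \<beta>) = ?p powr s"
        by (simp only: powr_add[symmetric]) (simp add: s_def)
      then show ?thesis by (simp add: power_mult_distrib mult_ac)
    qed
    finally have "(\<Sum>\<kappa>\<in>?G. (norm \<kappa>)\<^sup>2 * a \<kappa>) \<le> B * ?p powr s + 4 * K * ?p powr s"
      using Suc sum_filter_split[of ?G "\<lambda>\<kappa>. (norm \<kappa>)\<^sup>2 * a \<kappa>" "\<lambda>\<kappa>. norm \<kappa> \<le> ?p"] F
      unfolding sets by simp
    also have "\<dots> = (B + 4 * K) * ?p powr s" by (simp add: algebra_simps)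
    also have "\<dots> \<le> (B * q) * ?p powr s" using B by (intro mult_right_mono) auto
    also have "\<dots> = B * (2 * ?p) powr s" by (simp add: q_def powr_mult)
    finally show ?case by simp
  qed
  \<comment> \<open>The predecessor of the least power of 2 above 1 / |h|; it exists because |h|
    \<le> 1.\<close>
  have "\<exists>k. 2 ^ k \<le> 1 / norm h \<and> 1 / norm h < 2 ^ Suc k"
  proof -
    have ex: "\<exists>k. 1 / norm h < 2 ^ k" using real_arch_pow[of 2 "1 / norm h"] by auto
    define k where "k = (LEAST k. 1 / norm h < 2 ^ k)"
    have k: "1 / norm h < 2 ^ k" unfolding k_def using ex by (rule LeastI_ex)
    have "1 \<le> 1 / norm h" using h by simp
    then have "k \<noteq> 0" using k by (intro notI) simp
    then obtain l where l: "k = Suc l" using not0_implies_Suc by blast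
    then have "\<not> 1 / norm h < 2 ^ l" using not_less_Least[of l "\<lambda>k. 1 / norm h < 2 ^ k"] by (simp add: k_def)
    then show ?thesis using k l by (intro exI[of _ l]) auto
  qed
  then obtain k where k: "2 ^ k \<le> 1 / norm h" "1 / norm h < 2 ^ Suc k" by blast
  let ?p = "(2::real) ^ k"
  let ?L = "{\<kappa>\<in>F. norm \<kappa> \<le> ?p}" and ?H = "{\<kappa>\<in>F. \<not> norm \<kappa> \<le> ?p}"
  have "(\<Sum>\<kappa>\<in>?L. (cmod (chi \<kappa> h - 1))\<^sup>2 * a \<kappa>) \<le> (\<Sum>\<kappa>\<in>?L. (4 * pi\<^sup>2 * (norm h)\<^sup>2 * (norm \<kappa>)\<^sup>2) * a \<kappa>)"
    by (intro sum_mono mult_right_mono a norm_chi_minus_one_sq_le)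
  also have "\<dots> = 4 * pi\<^sup>2 * (norm h)\<^sup>2 * (\<Sum>\<kappa>\<in>?L. (norm \<kappa>)\<^sup>2 * a \<kappa>)"
    by (simp add: sum_distrib_left mult.assoc)
  also have "\<dots> \<le> 4 * pi\<^sup>2 * (norm h)\<^sup>2 * (B * ?p powr s)"
    by (intro mult_left_mono head) auto
  also have "\<dots> \<le> 4 * pi\<^sup>2 * (norm h)\<^sup>2 * (B * (1 / norm h) powr s)"
    using k B \<open>0 < s\<close> by (intro mult_left_mono powr_mono2) auto
  also have "\<dots> = 4 * pi\<^sup>2 * B * norm h powr (2 * \<beta>)"
  proof -
    have "(norm h)\<^sup>2 = norm h powr 2" using h by (simp add: powr_numeral)
    moreover have "(1 / norm h) powr s = norm h powr (- s)"
      using h by (simp add: powr_divide powr_minus_divide)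
    ultimately have "(norm h)\<^sup>2 * (1 / norm h) powr s = norm h powr (2 * \<beta>)"
      by (simp only: powr_add[symmetric]) (simp add: s_def)
    then show ?thesis by (simp add: mult_ac)
  qed
  finally have low: "(\<Sum>\<kappa>\<in>?L. (cmod (chi \<kappa> h - 1))\<^sup>2 * a \<kappa>) \<le> 4 * pi\<^sup>2 * B * norm h powr (2 * \<beta>)" .
  have "(\<Sum>\<kappa>\<in>?H. (cmod (chi \<kappa> h - 1))\<^sup>2 * a \<kappa>) \<le> (\<Sum>\<kappa>\<in>?H. 4 * a \<kappa>)"
    by (intro sum_mono mult_right_mono a norm_chi_minus_one_sq_le_4)
  also have "\<dots> = 4 * sum a ?H" by (simp add: sum_distrib_left)
  also have "\<dots> \<le> 4 * (K * ?p powr (- 2 * \<beta>))"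
    using F by (intro mult_left_mono tail) auto
  also have "?p powr (- 2 * \<beta>) \<le> (2 * norm h) powr (2 * \<beta>)"
  proof -
    have "?p powr (- 2 * \<beta>) = (1 / ?p) powr (2 * \<beta>)"
      by (simp add: powr_divide powr_minus_divide)
    also have "\<dots> \<le> (2 * norm h) powr (2 * \<beta>)"
      using k h \<open>0 < \<beta>\<close> by (intro powr_mono2) (auto simp: field_simps)
    finally show ?thesis .
  qed
  also have "(2 * norm h) powr (2 * \<beta>) = 2 powr (2 * \<beta>) * norm h powr (2 * \<beta>)"
    by (simp add: powr_mult)
  finally have "(\<Sum>\<kappa>\<in>?H. (cmod (chi \<kappa> h - 1))\<^sup>2 * a \<kappa>) \<le> 4 * (K * 2 powr (2 * \<beta>)) * norm h powr (2 * \<beta>)"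
    using \<open>0 \<le> K\<close> by (simp add: mult_left_mono mult.assoc)
  with low show "(\<Sum>\<kappa>\<in>F. (cmod (chi \<kappa> h - 1))\<^sup>2 * a \<kappa>) \<le> C * norm h powr (2 * \<beta>)"
    using sum_filter_split[of F "\<lambda>\<kappa>. (cmod (chi \<kappa> h - 1))\<^sup>2 * a \<kappa>" "\<lambda>\<kappa>. norm \<kappa> \<le> ?p"] F
    by (simp add: C_def algebra_simps)
qed

section \<open>Lipschitz classes in terms of Fourier tails\<close>

context lattice_domain
begin

abbreviation tail_sum where
  "tail_sum f N \<equiv> (\<Sum>\<^sub>\<infinity>\<kappa>\<in>{\<kappa> \<in> dual_lattice A. norm \<kappa> > real N}. (cmod (fc f \<kappa>))\<^sup>2)"

lemma summable_tail:
  "f \<in> sqint \<Longrightarrow> (\<lambda>\<kappa>. (cmod (fc f \<kappa>))\<^sup>2) summable_on {\<kappa> \<in> dual_lattice A. norm \<kappa> > real N}"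
  by (rule summable_on_subset_banach[OF has_sum_imp_summable[OF parseval]]) auto

lemma L2_space_increment:
  assumes "f \<in> L2_space A \<Omega>"
  shows "(\<lambda>x. f (x + h)) \<in> sqint" "(\<lambda>x. f (x + h) - f x) \<in> sqint"
proof -
  have f: "periodic f" "f \<in> sqint" using assms by (auto simp: L2_space_iff)
  have "periodic (\<lambda>x. (cmod (f x))\<^sup>2)" using f(1) by (simp add: periodic_def)
  then show "(\<lambda>x. f (x + h)) \<in> sqint"
    using borel_measurable_shift[OF f(1) sqintD(1)[OF f(2)], of h] integrable_shift[OF _ sqintD(2)[OF f(2)], of h]
    by (simp add: sqint_def)
  then show "(\<lambda>x. f (x + h) - f x) \<in> sqint" by (rule sqint_diff[OF _ f(2)])
qed

lemma increment_has_sum: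
  assumes "f \<in> L2_space A \<Omega>"
  shows "((\<lambda>\<kappa>. (cmod (chi \<kappa> h - 1))\<^sup>2 * (cmod (fc f \<kappa>))\<^sup>2) has_sum nsq (\<lambda>x. f (x + h) - f x)) (dual_lattice A)"
proof -
  have f: "f \<in> sqint" using assms by (auto simp: L2_space_iff)
  have "(cmod (fc (\<lambda>x. f (x + h) - f x) \<kappa>))\<^sup>2 = (cmod (chi \<kappa> h - 1))\<^sup>2 * (cmod (fc f \<kappa>))\<^sup>2"
    if "\<kappa> \<in> dual_lattice A" for \<kappa>
  proof -
    have "fc (\<lambda>x. f (x + h) - f x) \<kappa> = (chi \<kappa> h - 1) * fc f \<kappa>"
      by (simp add: fc_diff[OF L2_space_increment(1)[OF assms] f] fc_shift[OF assms that] algebra_simps)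
    then show ?thesis by (simp add: norm_mult power_mult_distrib)
  qed
  then show ?thesis
    using parseval[OF L2_space_increment(2)[OF assms, of h]] by (simp cong: has_sum_cong)
qed

lemma Lip_space_tail_bound:
  assumes f: "f \<in> Lip_space A \<Omega> \<alpha>" and "0 < \<alpha>"
  obtains K where "0 \<le> K" "\<And>r F. 0 < r \<Longrightarrow> finite F \<Longrightarrow> F \<subseteq> dual_lattice A \<Longrightarrow> (\<And>\<kappa>. \<kappa> \<in> F \<Longrightarrow> r \<le> norm \<kappa>) \<Longrightarrow>
    (\<Sum>\<kappa>\<in>F. (cmod (fc f \<kappa>))\<^sup>2) \<le> K * r powr (- 2 * \<alpha>)"
proof -
  have L2: "f \<in> L2_space A \<Omega>" and sq: "f \<in> sqint" using f by (auto simp: Lip_space_def L2_space_iff)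
  have "(\<lambda>h. L2_norm \<Omega> (\<lambda>x. f (x + h) - f x)) \<in> O[at 0](\<lambda>h. norm h powr \<alpha>)"
    using f by (simp add: Lip_space_def)
  then obtain c where c: "0 < c" "\<forall>\<^sub>F h in at 0. norm (L2_norm \<Omega> (\<lambda>x. f (x + h) - f x)) \<le> c * norm (norm h powr \<alpha>)"
    by (rule landau_o.bigE)
  then obtain d where d: "0 < d" "\<And>h. h \<noteq> 0 \<Longrightarrow> norm h < d \<Longrightarrow> sqrt (nsq (\<lambda>x. f (x + h) - f x)) \<le> c * norm h powr \<alpha>"
    unfolding eventually_at by (auto simp: L2_norm_eq nsq_nonneg)
  \<comment> \<open>\<open>tail_bound\<close> asks for all h \<noteq> 0, but the O-estimate covers
    only |h| < d. The second entry handles larger h through |chi - 1|^2 \<le> 4 and Bessel.\<close>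
  define C where "C = max (c\<^sup>2) (4 * nsq f / d powr (2 * \<alpha>))"
  have "0 \<le> C" by (simp add: C_def le_max_iff_disj)
  show thesis
  proof (rule tail_bound[of "\<lambda>\<kappa>. (cmod (fc f \<kappa>))\<^sup>2" \<alpha> C "dual_lattice A"])
    fix h :: "real^'n" and F assume h: "h \<noteq> 0" and F: "finite F" "F \<subseteq> dual_lattice A"
    let ?s = "\<Sum>\<kappa>\<in>F. (cmod (chi \<kappa> h - 1))\<^sup>2 * (cmod (fc f \<kappa>))\<^sup>2"
    show "?s \<le> C * norm h powr (2 * \<alpha>)"
    proof (cases "norm h < d")
      case True
      have "?s \<le> nsq (\<lambda>x. f (x + h) - f x)"
        by (rule finite_sum_le_has_sum[OF increment_has_sum[OF L2] F]) auto
      also have "\<dots> = (sqrt (nsq (\<lambda>x. f (x + h) - f x)))\<^sup>2" by (simp add: nsq_nonneg)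
      also have "\<dots> \<le> (c * norm h powr \<alpha>)\<^sup>2" using d(2)[OF h True] by (intro power_mono) (auto simp: nsq_nonneg)
      also have "\<dots> = c\<^sup>2 * norm h powr (2 * \<alpha>)"
        by (simp add: power_mult_distrib powr_double)
      also have "\<dots> \<le> C * norm h powr (2 * \<alpha>)" by (intro mult_right_mono) (auto simp: C_def)
      finally show ?thesis .
    next
      case False
      have "?s \<le> (\<Sum>\<kappa>\<in>F. 4 * (cmod (fc f \<kappa>))\<^sup>2)"
        by (intro sum_mono mult_right_mono norm_chi_minus_one_sq_le_4) auto
      also have "\<dots> \<le> 4 * nsq f" using bessel[OF sq F] by (simp add: sum_distrib_left[symmetric])
      also have "\<dots> = 4 * nsq f / d powr (2 * \<alpha>) * d powr (2 * \<alpha>)" using d(1) by simp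
      also have "\<dots> \<le> C * norm h powr (2 * \<alpha>)"
        using False d(1) \<open>0 < \<alpha>\<close> \<open>0 \<le> C\<close> by (intro mult_mono powr_mono2) (auto simp: C_def)
      finally show ?thesis .
    qed
  qed (use that \<open>0 < \<alpha>\<close> \<open>0 \<le> C\<close> in auto)
qed

text \<open>A tail estimate, rather than membership in \<open>Lip_space\<close>, is the hypothesis:
  the representative chosen by \<open>fourier_multiplier\<close> is known only through its
  coefficients.\<close>

lemma Lip_norm_finite:
  assumes g: "g \<in> L2_space A \<Omega>" and "0 < \<alpha>" "0 \<le> K"
    and tail: "\<And>r F. 0 < r \<Longrightarrow> finite F \<Longrightarrow> F \<subseteq> dual_lattice A \<Longrightarrow> (\<And>\<kappa>. \<kappa> \<in> F \<Longrightarrow> r \<le> norm \<kappa>) \<Longrightarrow>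
      (\<Sum>\<kappa>\<in>F. (cmod (fc g \<kappa>))\<^sup>2) \<le> K * r powr (- 2 * \<alpha>)"
  shows "Lip_norm A \<Omega> \<alpha> g < \<infinity>"
proof -
  \<comment> \<open>At N = 0 the term vanishes because \<open>0 powr \<alpha>\<close> is 0;
    otherwise the tail bound is taken at r = N.\<close>
  have "real N powr \<alpha> * sqrt (tail_sum g N) \<le> sqrt K" for N
  proof (cases "N = 0")
    case False
    then have N: "0 < real N" by simp
    have "tail_sum g N \<le> K * real N powr (- 2 * \<alpha>)"
      using g N by (intro infsum_le_finite_sums summable_tail tail) (auto simp: L2_space_iff)
    then have "real N powr \<alpha> * sqrt (tail_sum g N) \<le> real N powr \<alpha> * sqrt (K * real N powr (- 2 * \<alpha>))"
      by (intro mult_left_mono real_sqrt_le_mono) auto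
    also have "\<dots> = sqrt K * (real N powr \<alpha> * real N powr (- \<alpha>))"
    proof -
      have "real N powr (- 2 * \<alpha>) = (real N powr (- \<alpha>))\<^sup>2"
        using powr_double[of "real N" "- \<alpha>"] by simp
      then show ?thesis by (simp add: real_sqrt_mult)
    qed
    also have "\<dots> = sqrt K" using N by (simp add: powr_add[symmetric])
    finally show ?thesis .
  qed (use \<open>0 \<le> K\<close> \<open>0 < \<alpha>\<close> in simp)
  then have "(SUP N::nat. ennreal (real N powr \<alpha> * sqrt (tail_sum g N))) \<le> ennreal (sqrt K)"
    by (intro SUP_least ennreal_leI)
  also have "\<dots> < \<infinity>" by simp
  finally show ?thesis
    unfolding Lip_norm_def by simp
qed

text \<open>\<open>increment_bound\<close> with Bessel supplying S. Its uniform bound over finite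
  sets passes to the full increment by Parseval, and |h| \<le> 1 is enough of a neighbourhood for
  the O-estimate.\<close>

lemma Lip_space_of_tail_bound:
  assumes f: "f \<in> L2_space A \<Omega>" and "0 < \<beta>" "\<beta> < 1" "0 \<le> K"
    and tail: "\<And>r F. 0 < r \<Longrightarrow> finite F \<Longrightarrow> F \<subseteq> dual_lattice A \<Longrightarrow> (\<And>\<kappa>. \<kappa> \<in> F \<Longrightarrow> r \<le> norm \<kappa>) \<Longrightarrow>
      (\<Sum>\<kappa>\<in>F. (cmod (fc f \<kappa>))\<^sup>2) \<le> K * r powr (- 2 * \<beta>)"
  shows "f \<in> Lip_space A \<Omega> \<beta>"
proof -
  have sq: "f \<in> sqint" using f by (simp add: L2_space_iff)
  obtain C where C: "0 \<le> C" "\<And>h F. h \<noteq> 0 \<Longrightarrow> norm h \<le> 1 \<Longrightarrow> finite F \<Longrightarrow> F \<subseteq> dual_lattice A \<Longrightarrow>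
      (\<Sum>\<kappa>\<in>F. (cmod (chi \<kappa> h - 1))\<^sup>2 * (cmod (fc f \<kappa>))\<^sup>2) \<le> C * norm h powr (2 * \<beta>)"
    using increment_bound[of "\<lambda>\<kappa>. (cmod (fc f \<kappa>))\<^sup>2" \<beta> K "nsq f" "dual_lattice A"]
      assms(2-4) tail nsq_nonneg bessel[OF sq] by auto
  have "norm (L2_norm \<Omega> (\<lambda>x. f (x + h) - f x)) \<le> sqrt C * norm (norm h powr \<beta>)" if h: "h \<noteq> 0" "norm h \<le> 1" for h
  proof -
    have "nsq (\<lambda>x. f (x + h) - f x) \<le> C * norm h powr (2 * \<beta>)"
      by (rule has_sum_le_finite_sums[OF increment_has_sum[OF f]]) (intro C(2) h)
    then have "sqrt (nsq (\<lambda>x. f (x + h) - f x)) \<le> sqrt (C * norm h powr (2 * \<beta>))"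
      by (rule real_sqrt_le_mono)
    also have "norm h powr (2 * \<beta>) = (norm h powr \<beta>)\<^sup>2"
      by (rule powr_double)
    finally show ?thesis by (simp add: L2_norm_eq nsq_nonneg real_sqrt_mult)
  qed
  then have "(\<lambda>h. L2_norm \<Omega> (\<lambda>x. f (x + h) - f x)) \<in> O[at 0](\<lambda>h. norm h powr \<beta>)"
    by (intro bigoI[of _ "sqrt C"]) (auto simp: eventually_at intro!: exI[of _ 1])
  then show ?thesis using f by (simp add: Lip_space_def)
qed

section \<open>Effect of the multiplier on coefficients and norms\<close>

lemma multiplier_coeff:
  assumes "has_fourier_multiplier A \<Omega> (bessel_symbol \<gamma>) f g" "\<kappa> \<in> dual_lattice A"
  shows "(cmod (fc g \<kappa>))\<^sup>2 = (1 + 4 * pi\<^sup>2 * (norm \<kappa>)\<^sup>2) powr \<gamma> * (cmod (fc f \<kappa>))\<^sup>2"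
proof -
  have "fc g \<kappa> = complex_of_real (bessel_symbol \<gamma> \<kappa>) * fc f \<kappa>"
    using assms by (simp add: has_fourier_multiplier_def)
  moreover have "(bessel_symbol \<gamma> \<kappa>)\<^sup>2 = (1 + 4 * pi\<^sup>2 * (norm \<kappa>)\<^sup>2) powr \<gamma>"
    by (simp add: bessel_symbol_def laplace_symbol_def powr_double[symmetric])
  ultimately show ?thesis by (simp add: norm_mult power_mult_distrib)
qed

text \<open>The weight 1 + 4 pi^2 |\<kappa>|^2 is at least 1, which compares the full norms, and at
  least r^2 once |\<kappa>| \<ge> r, which gives the gain of order \<gamma> in the tails.\<close>

lemma multiplier_coeff_le:
  assumes "has_fourier_multiplier A \<Omega> (bessel_symbol \<gamma>) f g" "\<kappa> \<in> dual_lattice A" "0 \<le> \<gamma>"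
  shows "(cmod (fc f \<kappa>))\<^sup>2 \<le> (cmod (fc g \<kappa>))\<^sup>2"
    and "0 < r \<Longrightarrow> r \<le> norm \<kappa> \<Longrightarrow> (cmod (fc f \<kappa>))\<^sup>2 \<le> r powr (- 2 * \<gamma>) * (cmod (fc g \<kappa>))\<^sup>2"
proof -
  let ?w = "1 + 4 * pi\<^sup>2 * (norm \<kappa>)\<^sup>2"
  have "1 * (cmod (fc f \<kappa>))\<^sup>2 \<le> ?w powr \<gamma> * (cmod (fc f \<kappa>))\<^sup>2"
    using \<open>0 \<le> \<gamma>\<close> by (intro mult_right_mono ge_one_powr_ge_zero) auto
  then show "(cmod (fc f \<kappa>))\<^sup>2 \<le> (cmod (fc g \<kappa>))\<^sup>2"
    by (simp add: multiplier_coeff[OF assms(1,2)])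
  assume r: "0 < r" "r \<le> norm \<kappa>"
  have "r\<^sup>2 \<le> ?w"
  proof -
    have "r\<^sup>2 \<le> (norm \<kappa>)\<^sup>2" using r by (intro power_mono) auto
    also have "\<dots> \<le> (4 * pi\<^sup>2) * (norm \<kappa>)\<^sup>2"
    proof -
      have "1 \<le> pi\<^sup>2" using pi_gt3 by (intro one_le_power) auto
      then have "1 * (norm \<kappa>)\<^sup>2 \<le> (4 * pi\<^sup>2) * (norm \<kappa>)\<^sup>2" by (intro mult_right_mono) auto
      then show ?thesis by simp
    qed
    finally show ?thesis by simp
  qed
  then have "(r\<^sup>2) powr \<gamma> \<le> ?w powr \<gamma>" using \<open>0 \<le> \<gamma>\<close> by (intro powr_mono2) auto
  moreover have "(r\<^sup>2) powr \<gamma> = r powr (2 * \<gamma>)"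
    using r by (simp add: powr_double power2_eq_square powr_mult)
  ultimately have "r powr (- 2 * \<gamma>) * r powr (2 * \<gamma>) * (cmod (fc f \<kappa>))\<^sup>2
      \<le> r powr (- 2 * \<gamma>) * ?w powr \<gamma> * (cmod (fc f \<kappa>))\<^sup>2"
    by (intro mult_right_mono mult_left_mono) auto
  moreover have "r powr (- 2 * \<gamma>) * r powr (2 * \<gamma>) = 1"
    using r by (simp add: powr_add[symmetric])
  ultimately show "(cmod (fc f \<kappa>))\<^sup>2 \<le> r powr (- 2 * \<gamma>) * (cmod (fc g \<kappa>))\<^sup>2"
    by (simp only: multiplier_coeff[OF assms(1,2)] mult.assoc[symmetric] mult_1_left)
qed

text \<open>Beyond N the coefficients of f gain a factor N^(- \<gamma>), which exactly pays for the
  larger exponent \<alpha> + \<gamma>. The suprema therefore compare at the same N with constant 1;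
  at N = 0 both terms are 0.\<close>

lemma Lip_norm_multiplier_le:
  assumes fm: "has_fourier_multiplier A \<Omega> (bessel_symbol \<gamma>) f g" and f: "f \<in> sqint" and "0 \<le> \<gamma>" "0 < \<alpha>"
  shows "Lip_norm A \<Omega> (\<alpha> + \<gamma>) f \<le> Lip_norm A \<Omega> \<alpha> g"
  unfolding Lip_norm_def
proof (intro add_mono ennreal_leI SUP_mono)
  have g: "g \<in> sqint" using fm by (simp add: has_fourier_multiplier_def L2_space_iff)
  have "nsq f \<le> nsq g"
    by (rule has_sum_mono[OF parseval[OF f] parseval[OF g]]) (rule multiplier_coeff_le[OF fm _ \<open>0 \<le> \<gamma>\<close>])
  then show "L2_norm \<Omega> f \<le> L2_norm \<Omega> g" by (simp add: L2_norm_eq)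
  fix N :: nat
  have "real N powr (\<alpha> + \<gamma>) * sqrt (tail_sum f N) \<le> real N powr \<alpha> * sqrt (tail_sum g N)"
  proof (cases "N = 0")
    case False
    then have N: "0 < real N" by simp
    have "tail_sum f N \<le> (\<Sum>\<^sub>\<infinity>\<kappa>\<in>{\<kappa> \<in> dual_lattice A. norm \<kappa> > real N}. real N powr (- 2 * \<gamma>) * (cmod (fc g \<kappa>))\<^sup>2)"
      using N by (intro infsum_mono summable_tail f g summable_on_cmult_right multiplier_coeff_le(2)[OF fm _ \<open>0 \<le> \<gamma>\<close>]) auto
    also have "\<dots> = real N powr (- 2 * \<gamma>) * tail_sum g N"
      by (rule infsum_cmult_right) (intro summable_tail g)
    finally have "real N powr (\<alpha> + \<gamma>) * sqrt (tail_sum f N) \<le> real N powr (\<alpha> + \<gamma>) * sqrt (real N powr (- 2 * \<gamma>) * tail_sum g N)"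
      by (intro mult_left_mono real_sqrt_le_mono) auto
    also have "\<dots> = (real N powr (\<alpha> + \<gamma>) * real N powr (- \<gamma>)) * sqrt (tail_sum g N)"
    proof -
      have "real N powr (- 2 * \<gamma>) = (real N powr (- \<gamma>))\<^sup>2"
        using powr_double[of "real N" "- \<gamma>"] by simp
      then show ?thesis by (simp add: real_sqrt_mult)
    qed
    also have "real N powr (\<alpha> + \<gamma>) * real N powr (- \<gamma>) = real N powr \<alpha>"
      by (simp add: powr_add[symmetric])
    finally show ?thesis .
  qed (use \<open>0 < \<alpha>\<close> \<open>0 \<le> \<gamma>\<close> in simp)
  then show "\<exists>M\<in>UNIV. ennreal (real N powr (\<alpha> + \<gamma>) * sqrt (tail_sum f N)) \<le> ennreal (real M powr \<alpha> * sqrt (tail_sum g M))"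
    by (blast intro: ennreal_leI)
qed

end

section \<open>The embedding\<close>

theorem corollary4p3:
  fixes A :: "real^'n^'n" and \<Omega> :: "(real^'n) set" and \<alpha> \<gamma> :: real
  assumes "invertible A"
    and "fundamental_domain A \<Omega>"
    and "0 \<le> \<gamma>" and "\<gamma> < 1"
    and "0 < \<alpha>" and "\<alpha> < 1 - \<gamma>"
  shows "continuously_embedded
           (HLip_space A \<Omega> \<gamma> \<alpha>) (HLip_norm A \<Omega> \<gamma> \<alpha>)
           (Lip_space A \<Omega> (\<alpha> + \<gamma>)) (Lip_norm A \<Omega> (\<alpha> + \<gamma>))"
proof -
  interpret lattice_domain A \<Omega> by standard fact+
  let ?D = "dual_lattice A" and ?\<sigma> = "bessel_symbol \<gamma> :: real^'n \<Rightarrow> real"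
  have \<beta>: "0 < \<alpha> + \<gamma>" "\<alpha> + \<gamma> < 1" using assms by auto
  have fm: "has_fourier_multiplier A \<Omega> ?\<sigma> f (fourier_multiplier A \<Omega> ?\<sigma> f)"
    if "f \<in> HLip_space A \<Omega> \<gamma> \<alpha>" for f
    using that someI_ex[of "has_fourier_multiplier A \<Omega> ?\<sigma> f"]
    unfolding HLip_space_def fourier_multiplier_def by blast
  have "HLip_norm A \<Omega> \<gamma> \<alpha> f < \<infinity>" if f: "f \<in> HLip_space A \<Omega> \<gamma> \<alpha>" for f
  proof -
    let ?g' = "fourier_multiplier A \<Omega> ?\<sigma> f"
    obtain g where g: "g \<in> Lip_space A \<Omega> \<alpha>" "has_fourier_multiplier A \<Omega> ?\<sigma> f g"
      using f by (auto simp: HLip_space_def)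
    obtain K where K: "0 \<le> K" "\<And>r F. 0 < r \<Longrightarrow> finite F \<Longrightarrow> F \<subseteq> ?D \<Longrightarrow> (\<And>\<kappa>. \<kappa> \<in> F \<Longrightarrow> r \<le> norm \<kappa>) \<Longrightarrow>
        (\<Sum>\<kappa>\<in>F. (cmod (fc g \<kappa>))\<^sup>2) \<le> K * r powr (- 2 * \<alpha>)"
      using Lip_space_tail_bound[OF g(1) \<open>0 < \<alpha>\<close>] by blast
    \<comment> \<open>The chosen representative and the Lipschitz witness have the same
      coefficients, so the tail bound of g carries over.\<close>
    have eq: "fc ?g' \<kappa> = fc g \<kappa>" if "\<kappa> \<in> ?D" for \<kappa>
      using fm[OF f] g(2) that by (simp add: has_fourier_multiplier_def)
    have "Lip_norm A \<Omega> \<alpha> ?g' < \<infinity>"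
    proof (rule Lip_norm_finite[OF _ \<open>0 < \<alpha>\<close> K(1)])
      show "?g' \<in> L2_space A \<Omega>" using fm[OF f] by (simp add: has_fourier_multiplier_def)
      fix r F assume F: "0 < r" "finite F" "F \<subseteq> ?D" "\<And>\<kappa>. \<kappa> \<in> F \<Longrightarrow> r \<le> norm \<kappa>"
      have "(\<Sum>\<kappa>\<in>F. (cmod (fc ?g' \<kappa>))\<^sup>2) = (\<Sum>\<kappa>\<in>F. (cmod (fc g \<kappa>))\<^sup>2)"
        using F(3) eq by (intro sum.cong) auto
      also have "\<dots> \<le> K * r powr (- 2 * \<alpha>)" by (intro K F)
      finally show "(\<Sum>\<kappa>\<in>F. (cmod (fc ?g' \<kappa>))\<^sup>2) \<le> K * r powr (- 2 * \<alpha>)" .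
    qed
    then show ?thesis by (simp add: HLip_norm_def)
  qed
  moreover have "Lip_norm A \<Omega> (\<alpha> + \<gamma>) f < \<infinity>" if f: "f \<in> Lip_space A \<Omega> (\<alpha> + \<gamma>)" for f
  proof -
    obtain K where "0 \<le> K" "\<And>r F. 0 < r \<Longrightarrow> finite F \<Longrightarrow> F \<subseteq> ?D \<Longrightarrow> (\<And>\<kappa>. \<kappa> \<in> F \<Longrightarrow> r \<le> norm \<kappa>) \<Longrightarrow>
        (\<Sum>\<kappa>\<in>F. (cmod (fc f \<kappa>))\<^sup>2) \<le> K * r powr (- 2 * (\<alpha> + \<gamma>))"
      using Lip_space_tail_bound[OF f \<beta>(1)] by blast
    then show ?thesis
      using f \<beta>(1) by (intro Lip_norm_finite[of f "\<alpha> + \<gamma>" K]) (auto simp: Lip_space_def)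
  qed
  moreover have "f \<in> Lip_space A \<Omega> (\<alpha> + \<gamma>)" if f: "f \<in> HLip_space A \<Omega> \<gamma> \<alpha>" for f
  proof -
    have L2: "f \<in> L2_space A \<Omega>" using f by (simp add: HLip_space_def Lip_space_def)
    obtain g where g: "g \<in> Lip_space A \<Omega> \<alpha>" "has_fourier_multiplier A \<Omega> ?\<sigma> f g"
      using f by (auto simp: HLip_space_def)
    obtain K where K: "0 \<le> K" "\<And>r F. 0 < r \<Longrightarrow> finite F \<Longrightarrow> F \<subseteq> ?D \<Longrightarrow> (\<And>\<kappa>. \<kappa> \<in> F \<Longrightarrow> r \<le> norm \<kappa>) \<Longrightarrow>
        (\<Sum>\<kappa>\<in>F. (cmod (fc g \<kappa>))\<^sup>2) \<le> K * r powr (- 2 * \<alpha>)"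
      using Lip_space_tail_bound[OF g(1) \<open>0 < \<alpha>\<close>] by blast
    show ?thesis
    proof (rule Lip_space_of_tail_bound[OF L2 \<beta> K(1)])
      fix r F assume F: "0 < r" "finite F" "F \<subseteq> ?D" "\<And>\<kappa>. \<kappa> \<in> F \<Longrightarrow> r \<le> norm \<kappa>"
      have "(\<Sum>\<kappa>\<in>F. (cmod (fc f \<kappa>))\<^sup>2) \<le> (\<Sum>\<kappa>\<in>F. r powr (- 2 * \<gamma>) * (cmod (fc g \<kappa>))\<^sup>2)"
        using F by (intro sum_mono multiplier_coeff_le(2)[OF g(2) _ \<open>0 \<le> \<gamma>\<close>]) auto
      also have "\<dots> = r powr (- 2 * \<gamma>) * (\<Sum>\<kappa>\<in>F. (cmod (fc g \<kappa>))\<^sup>2)"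
        by (simp add: sum_distrib_left)
      also have "\<dots> \<le> r powr (- 2 * \<gamma>) * (K * r powr (- 2 * \<alpha>))"
        by (intro mult_left_mono K F) auto
      also have "\<dots> = K * r powr (- 2 * (\<alpha> + \<gamma>))"
        by (simp add: powr_add[symmetric] algebra_simps)
      finally show "(\<Sum>\<kappa>\<in>F. (cmod (fc f \<kappa>))\<^sup>2) \<le> K * r powr (- 2 * (\<alpha> + \<gamma>))" .
    qed
  qed
  moreover have "Lip_norm A \<Omega> (\<alpha> + \<gamma>) f \<le> ennreal 1 * HLip_norm A \<Omega> \<gamma> \<alpha> f"
    if f: "f \<in> HLip_space A \<Omega> \<gamma> \<alpha>" for f
  proof -
    have "f \<in> sqint" using f by (simp add: HLip_space_def Lip_space_def L2_space_iff)
    then show ?thesis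
      using Lip_norm_multiplier_le[OF fm[OF f] _ assms(3,5)] by (simp add: HLip_norm_def)
  qed
  ultimately show ?thesis
    unfolding continuously_embedded_def by blast
qed

end
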